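(* Let $f$ be a monic irreducible element of $R$ with $f\notin Z(R)$, whose bound is $F(x^n)$ with $F(y)\in\mathbb{K}[y]$ monic irreducible of degree $s$, $F(y)\ne y$, and assume $\deg f=s\ell$ with $\ell=\ell_F$. Let $\rho\in\mathrm{Aut}(\mathbb{L})$, $\mathbb{K}'=\mathrm{Fix}_{\mathbb{L}}(\rho)\cap\mathbb{K}$ with $\mathbb{K}/\mathbb{K}'$ finite, and $\eta\in\mathbb{L}$, $\eta\ne0$, with $\mathrm{N}_{\mathbb{L}/\mathbb{K}'}(\eta f_0)\ne1$, $f_0$ the constant coefficient of $f$. Assume $s\ell>2$. Let $z(x^n)\in Z(R)$ satisfy $z(x^n)x^{sn}\equiv1\pmod{Rf}$ and let $\mathbb{A}=(R/Rf,\star_{S'})$ with $$\Big((a_0-\eta\rho(a_0)f_0)+\sum_{i=1}^{s\ell-1}a_ix^i\Big)\star_{S'}b:=\Big((a_0-\eta\rho(a_0)f_0)+\sum_{i=1}^{s\ell-1}a_ix^i+\eta\rho(a_0)f(x)\Big)z(x^n)x^{sn-1}\,b\bmod_r f,$$ a unital division algebra over $\mathbb{K}'$. Then $$\mathbb{N}_l(\mathbb{A})\cong\mathrm{Fix}_{\mathbb{L}}(\rho),\quad \mathbb{N}_m(\mathbb{A})\cong\mathrm{Fix}_{\mathbb{L}}(\rho^{-1}\circ\sigma^{s\ell}),\quad \mathbb{N}_r(\mathbb{A})\cong\mathcal{E}(f),\quad Z(\mathbb{A})\cong\mathbb{K}'.$$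
   Context: $\mathbb{K}$ is a field, $\mathbb{L}/\mathbb{K}$ cyclic Galois of degree $n\ge2$, $\sigma$ a generator of $\mathrm{Gal}(\mathbb{L}/\mathbb{K})$, $R=\mathbb{L}[x;\sigma]$ with $xa=\sigma(a)x$, $Z(R)=\mathbb{K}[x^n]$. The bound of $f$ is the monic central polynomial generating the largest two-sided ideal in $Rf$; $\ell_F=n/m$ with $m$ the number of irreducible factors of $F(x^n)$ in $R$. $R/Rf$ is identified with polynomials of degree $<\deg f$; every element is uniquely of the form $(a_0-\eta\rho(a_0)f_0)+\sum_{i\ge1}a_ix^i$, $a_i\in\mathbb{L}$. The eigenring is $\mathcal{E}(f)=\{g\in R:\deg g<\deg f,\ fg\in Rf\}$ with multiplication modulo $Rf$. For an algebra $(\mathbb{A},\star)$: $\mathbb{N}_l=\{a:a\star(b\star c)=(a\star b)\star c\ \forall b,c\}$, $\mathbb{N}_m=\{b:\dots\ \forall a,c\}$, $\mathbb{N}_r=\{c:\dots\ \forall a,b\}$, and $Z(\mathbb{A})$ is the set of elements of $\mathbb{N}_l\cap\mathbb{N}_m\cap\mathbb{N}_r$ commuting with all elements. *)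

theory Defs
  imports
    "HOL-Algebra.Embedded_Algebras"
    "HOL-Algebra.Algebraic_Closure_Type"
    "HOL-Algebra.QuotRing"
    "HOL-Algebra.Module"
    "HOL-Computational_Algebra.Polynomial"
    "Jordan_Normal_Form.Determinant"
begin

section \<open>Subfields, Galois groups and norms\<close>

text \<open>The field \<open>L\<close> is the type \<open>'a\<close>, viewed as a HOL-Algebra ring;
  its subfields are subsets of \<open>'a\<close>.\<close>

abbreviation fld :: "'a::field ring" where
  "fld \<equiv> ring_of_type_algebra"

definition fixed_by :: "('a \<Rightarrow> 'a) \<Rightarrow> 'a set" where
  "fixed_by \<tau> = {a. \<tau> a = a}"

definition galois_group :: "'a::field set \<Rightarrow> ('a \<Rightarrow> 'a) set" where
  "galois_group K = {\<tau> \<in> ring_iso fld fld. K \<subseteq> fixed_by \<tau>}"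

text \<open>\<open>L/K\<close> is cyclic Galois of degree \<open>n\<close>, and \<open>\<sigma>\<close> generates its Galois group.
  By finiteness, nonnegative powers of \<open>\<sigma>\<close> suffice.\<close>

definition cyclic_galois :: "'a::field set \<Rightarrow> nat \<Rightarrow> ('a \<Rightarrow> 'a) \<Rightarrow> bool" where
  "cyclic_galois K n \<sigma> \<longleftrightarrow>
     subfield K fld \<and>
     ring.dimension fld n K UNIV \<and>
     (\<Inter>\<tau>\<in>galois_group K. fixed_by \<tau>) = K \<and>
     \<sigma> \<in> galois_group K \<and>
     galois_group K = range (\<lambda>i::nat. \<sigma> ^^ i)"

text \<open>The norm of a finite extension \<open>L/F\<close>, not assumed separable: the determinant of the
  \<open>F\<close>-linear map \<open>y \<mapsto> a y\<close> with respect to any \<open>F\<close>-basis \<open>bs\<close> of \<open>L\<close>.\<close>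

definition field_norm :: "'a::field set \<Rightarrow> 'a \<Rightarrow> 'a" where
  "field_norm F a = (THE d. \<exists>bs M.
     ring.independent fld F bs \<and> ring.Span fld F bs = UNIV \<and>
     M \<in> carrier_mat (length bs) (length bs) \<and>
     (\<forall>i<length bs. \<forall>j<length bs. M $$ (i, j) \<in> F) \<and>
     (\<forall>j<length bs. a * bs ! j = (\<Sum>i<length bs. M $$ (i, j) * bs ! i)) \<and>
     d = det M)"

section \<open>Ring-theoretic notions without commutativity\<close>

definition irreducible_elt :: "('b, 'm) ring_scheme \<Rightarrow> 'b \<Rightarrow> bool" where
  "irreducible_elt R p \<longleftrightarrow>
     p \<in> carrier R \<and> p \<noteq> \<zero>\<^bsub>R\<^esub> \<and> p \<notin> Units R \<and>
     (\<forall>g\<in>carrier R. \<forall>h\<in>carrier R. p = g \<otimes>\<^bsub>R\<^esub> h \<longrightarrow> g \<in> Units R \<or> h \<in> Units R)"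

definition irreducible_factorization :: "('b, 'm) ring_scheme \<Rightarrow> 'b \<Rightarrow> 'b list \<Rightarrow> bool" where
  "irreducible_factorization R c ps \<longleftrightarrow>
     (\<forall>p\<in>set ps. irreducible_elt R p) \<and> c = foldr (\<lambda>p q. p \<otimes>\<^bsub>R\<^esub> q) ps \<one>\<^bsub>R\<^esub>"

definition commutative_center :: "('b, 'm) ring_scheme \<Rightarrow> 'b set" where
  "commutative_center R = {c \<in> carrier R. \<forall>a\<in>carrier R. c \<otimes>\<^bsub>R\<^esub> a = a \<otimes>\<^bsub>R\<^esub> c}"

section \<open>The skew polynomial ring \<open>L[x;\<sigma>]\<close>\<close>

text \<open>Elements \<open>\<Sum> a\<^sub>i x\<^sup>i\<close> have their coefficients on the left and are represented by the ordinary
  polynomial with the same coefficients; in the product, \<open>x\<^sup>i a = \<sigma>\<^sup>i(a) x\<^sup>i\<close>.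
  In particular \<open>smult c f\<close> is the product of the constant \<open>c\<close> with \<open>f\<close>.\<close>

definition skew_mult :: "('a::field \<Rightarrow> 'a) \<Rightarrow> 'a poly \<Rightarrow> 'a poly \<Rightarrow> 'a poly" where
  "skew_mult \<sigma> f g =
     (\<Sum>i\<le>degree f. \<Sum>j\<le>degree g. monom (coeff f i * (\<sigma> ^^ i) (coeff g j)) (i + j))"

definition skew_ring :: "('a::field \<Rightarrow> 'a) \<Rightarrow> 'a poly ring" where
  "skew_ring \<sigma> = \<lparr>carrier = UNIV, monoid.mult = skew_mult \<sigma>, one = 1, zero = 0, add = (+)\<rparr>"

text \<open>The commutative ring \<open>K[y]\<close>, and the substitution \<open>y := x\<^sup>n\<close>. As \<open>x\<^sup>n\<close> is central when
  \<open>\<sigma>\<^sup>n = id\<close>, the commutative composition gives the right element of the skew ring.\<close>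

definition poly_over :: "'a::field set \<Rightarrow> 'a poly ring" where
  "poly_over K = \<lparr>carrier = {p. \<forall>i. coeff p i \<in> K}, monoid.mult = (*), one = 1, zero = 0, add = (+)\<rparr>"

definition at_power :: "'a::field poly \<Rightarrow> nat \<Rightarrow> 'a poly" where
  "at_power F n = pcompose F (monom 1 n)"

text \<open>\<open>cgenideal R f\<close> is \<open>{g \<otimes> f | g. g \<in> carrier R}\<close>, that is, the left ideal \<open>Rf\<close>;
  \<open>ideal\<close> is two-sided.\<close>

definition is_bound :: "('a::field \<Rightarrow> 'a) \<Rightarrow> 'a poly \<Rightarrow> 'a poly \<Rightarrow> bool" where
  "is_bound \<sigma> f c \<longleftrightarrow> (let R = skew_ring \<sigma> in
     lead_coeff c = 1 \<and> c \<in> commutative_center R \<and>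
     ideal (cgenideal R c) R \<and> cgenideal R c \<subseteq> cgenideal R f \<and>
     (\<forall>I. ideal I R \<and> I \<subseteq> cgenideal R f \<longrightarrow> I \<subseteq> cgenideal R c))"

text \<open>The remainder of right division by \<open>f\<close>. The condition \<open>degree r < degree f\<close> is only adequate
  for \<open>f\<close> of positive degree, since the zero polynomial has degree 0.\<close>

definition mod_r :: "('a::field \<Rightarrow> 'a) \<Rightarrow> 'a poly \<Rightarrow> 'a poly \<Rightarrow> 'a poly" where
  "mod_r \<sigma> g f = (THE r. degree r < degree f \<and> g - r \<in> cgenideal (skew_ring \<sigma>) f)"

section \<open>Algebras\<close>

text \<open>A not necessarily associative algebra is a \<open>module\<close> record, which carries both a
  multiplication and a scalar multiplication.\<close>

definition unital_division_algebra :: "('k, 'r) ring_scheme \<Rightarrow> ('k, 'b, 'm) module_scheme \<Rightarrow> bool" where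
  "unital_division_algebra F A \<longleftrightarrow>
     field F \<and> Module.module F A \<and>
     (\<forall>a\<in>carrier A. \<forall>b\<in>carrier A. a \<otimes>\<^bsub>A\<^esub> b \<in> carrier A) \<and>
     (\<forall>a\<in>carrier A. \<forall>b\<in>carrier A. \<forall>c\<in>carrier A.
        (a \<oplus>\<^bsub>A\<^esub> b) \<otimes>\<^bsub>A\<^esub> c = (a \<otimes>\<^bsub>A\<^esub> c) \<oplus>\<^bsub>A\<^esub> (b \<otimes>\<^bsub>A\<^esub> c) \<and>
        a \<otimes>\<^bsub>A\<^esub> (b \<oplus>\<^bsub>A\<^esub> c) = (a \<otimes>\<^bsub>A\<^esub> b) \<oplus>\<^bsub>A\<^esub> (a \<otimes>\<^bsub>A\<^esub> c)) \<and>
     (\<forall>k\<in>carrier F. \<forall>a\<in>carrier A. \<forall>b\<in>carrier A.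
        (k \<odot>\<^bsub>A\<^esub> a) \<otimes>\<^bsub>A\<^esub> b = k \<odot>\<^bsub>A\<^esub> (a \<otimes>\<^bsub>A\<^esub> b) \<and>
        a \<otimes>\<^bsub>A\<^esub> (k \<odot>\<^bsub>A\<^esub> b) = k \<odot>\<^bsub>A\<^esub> (a \<otimes>\<^bsub>A\<^esub> b)) \<and>
     \<one>\<^bsub>A\<^esub> \<in> carrier A \<and> \<one>\<^bsub>A\<^esub> \<noteq> \<zero>\<^bsub>A\<^esub> \<and>
     (\<forall>a\<in>carrier A. \<one>\<^bsub>A\<^esub> \<otimes>\<^bsub>A\<^esub> a = a \<and> a \<otimes>\<^bsub>A\<^esub> \<one>\<^bsub>A\<^esub> = a) \<and>
     (\<forall>a\<in>carrier A. a \<noteq> \<zero>\<^bsub>A\<^esub> \<longrightarrow>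
        bij_betw (\<lambda>b. a \<otimes>\<^bsub>A\<^esub> b) (carrier A) (carrier A) \<and>
        bij_betw (\<lambda>b. b \<otimes>\<^bsub>A\<^esub> a) (carrier A) (carrier A))"

definition left_nucleus :: "('b, 'm) ring_scheme \<Rightarrow> 'b set" where
  "left_nucleus A = {a \<in> carrier A. \<forall>b\<in>carrier A. \<forall>c\<in>carrier A.
     a \<otimes>\<^bsub>A\<^esub> (b \<otimes>\<^bsub>A\<^esub> c) = (a \<otimes>\<^bsub>A\<^esub> b) \<otimes>\<^bsub>A\<^esub> c}"

definition middle_nucleus :: "('b, 'm) ring_scheme \<Rightarrow> 'b set" where
  "middle_nucleus A = {b \<in> carrier A. \<forall>a\<in>carrier A. \<forall>c\<in>carrier A.
     a \<otimes>\<^bsub>A\<^esub> (b \<otimes>\<^bsub>A\<^esub> c) = (a \<otimes>\<^bsub>A\<^esub> b) \<otimes>\<^bsub>A\<^esub> c}"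

definition right_nucleus :: "('b, 'm) ring_scheme \<Rightarrow> 'b set" where
  "right_nucleus A = {c \<in> carrier A. \<forall>a\<in>carrier A. \<forall>b\<in>carrier A.
     a \<otimes>\<^bsub>A\<^esub> (b \<otimes>\<^bsub>A\<^esub> c) = (a \<otimes>\<^bsub>A\<^esub> b) \<otimes>\<^bsub>A\<^esub> c}"

definition algebra_center :: "('b, 'm) ring_scheme \<Rightarrow> 'b set" where
  "algebra_center A =
     left_nucleus A \<inter> middle_nucleus A \<inter> right_nucleus A \<inter> commutative_center A"

abbreviation restrict_to :: "('k, 'b) module \<Rightarrow> 'b set \<Rightarrow> ('k, 'b) module" where
  "restrict_to A S \<equiv> A\<lparr>carrier := S\<rparr>"

definition algebra_isomorphic ::
    "'k set \<Rightarrow> ('k, 'b, 'm) module_scheme \<Rightarrow> ('k, 'c, 'n) module_scheme \<Rightarrow> bool" where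
  "algebra_isomorphic F A B \<longleftrightarrow> (\<exists>h\<in>ring_iso A B.
     \<forall>k\<in>F. \<forall>a\<in>carrier A. h (k \<odot>\<^bsub>A\<^esub> a) = k \<odot>\<^bsub>B\<^esub> h a)"

definition subfield_algebra :: "'a::field set \<Rightarrow> ('a, 'a) module" where
  "subfield_algebra S =
     \<lparr>carrier = S, monoid.mult = (*), one = 1, zero = 0, add = (+), module.smult = (*)\<rparr>"

definition eigenring :: "('a::field \<Rightarrow> 'a) \<Rightarrow> 'a poly \<Rightarrow> ('a, 'a poly) module" where
  "eigenring \<sigma> f =
     \<lparr>carrier = {g. degree g < degree f \<and> skew_mult \<sigma> f g \<in> cgenideal (skew_ring \<sigma>) f},
      monoid.mult = (\<lambda>g h. mod_r \<sigma> (skew_mult \<sigma> g h) f),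
      one = 1, zero = 0, add = (+), module.smult = Polynomial.smult\<rparr>"

section \<open>The algebra \<open>(R/Rf, \<star>)\<close>\<close>

text \<open>The parameter \<open>u\<close> stands for \<open>z(x\<^sup>n) x\<^sup>s\<^sup>n\<^sup>-\<^sup>1\<close>. A polynomial \<open>a\<close> of degree less than that of \<open>f\<close>
  has constant coefficient \<open>a\<^sub>0 - \<eta> \<rho>(a\<^sub>0) f\<^sub>0\<close> for a unique \<open>a\<^sub>0\<close>.\<close>

definition star :: "('a::field \<Rightarrow> 'a) \<Rightarrow> ('a \<Rightarrow> 'a) \<Rightarrow> 'a \<Rightarrow> 'a poly \<Rightarrow> 'a poly \<Rightarrow>
    'a poly \<Rightarrow> 'a poly \<Rightarrow> 'a poly" where
  "star \<sigma> \<rho> \<eta> f u a b =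
     (let a0 = (THE c. c - \<eta> * \<rho> c * coeff f 0 = coeff a 0)
      in mod_r \<sigma> (skew_mult \<sigma> (skew_mult \<sigma> (a + Polynomial.smult (\<eta> * \<rho> a0) f) u) b) f)"

text \<open>Since \<open>x u \<equiv> 1\<close> modulo \<open>Rf\<close>, the identity of this algebra is \<open>x\<close>, not \<open>1\<close>.\<close>

definition star_algebra :: "('a::field \<Rightarrow> 'a) \<Rightarrow> ('a \<Rightarrow> 'a) \<Rightarrow> 'a \<Rightarrow> 'a poly \<Rightarrow> 'a poly \<Rightarrow>
    ('a, 'a poly) module" where
  "star_algebra \<sigma> \<rho> \<eta> f u =
     \<lparr>carrier = {g. degree g < degree f}, monoid.mult = star \<sigma> \<rho> \<eta> f u,
      one = monom 1 1, zero = 0, add = (+), module.smult = Polynomial.smult\<rparr>"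

end

theory Submission
  imports Defs
begin

text \<open>The element \<open>a\<close> acts in the product \<open>\<star>\<close> through its representative \<open>g = a + \<eta> \<rho>(a\<^sub>0) f\<close> modulo \<open>Rf\<close>; these
  representatives form the set \<open>S\<close> of polynomials of degree at most \<open>d = s \<ell>\<close> with \<open>g\<^sub>d = \<eta> \<rho>(g\<^sub>0)\<close>.

  Division: if a nonzero \<open>g \<in> S\<close> kills a nonzero \<open>b\<close> in the simple module \<open>R/Rf\<close>, then \<open>g\<close> has degree \<open>d\<close>
  and \<open>R/Rg\<close> is isomorphic to \<open>R/Rf\<close> by \<open>r \<mapsto> r b\<close>. Comparing the determinants of the semilinear
  map \<open>x\<close> on both sides gives \<open>g\<^sub>0 t = g\<^sub>d f\<^sub>0 \<sigma>(t)\<close> with \<open>t \<noteq> 0\<close>, hence \<open>N(\<eta> f\<^sub>0) = 1\<close>, since the norm to \<open>K'\<close>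
  is invariant under \<open>\<rho>\<close> and \<open>\<sigma>\<close>.

  Nuclei: \<open>u\<close> is inverse to \<open>x\<close> modulo the annihilator \<open>Ann\<close> of \<open>R/Rf\<close>, which is generated by the bound. So
  the left and middle nuclei correspond to the left and right idealisers of \<open>S\<close> modulo \<open>Ann\<close>. The
  bound has degree at least \<open>2 d\<close>, so congruences modulo \<open>Ann\<close> between polynomials of degree at most
  \<open>d + 1\<close> are equalities, and comparing degrees of multiples by powers of \<open>x\<close> leaves only constants.
  The right nucleus consists of the values at the identity \<open>x\<close> of the endomorphisms of the left module \<open>R/Rf\<close>.\<close>

section \<open>The skew polynomial ring\<close>

text \<open>The hypotheses fit every field automorphism, so the locale is instantiated also by the
  powers of the twist, by \<open>\<rho>\<close> and by the identity.\<close>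

locale skew_poly =
  fixes \<sigma> :: "'a::field \<Rightarrow> 'a"
  assumes sigma_add [simp]: "\<sigma> (a + b) = \<sigma> a + \<sigma> b"
    and sigma_mult [simp]: "\<sigma> (a * b) = \<sigma> a * \<sigma> b"
    and sigma_bij: "bij \<sigma>"
begin

abbreviation smul :: "'a poly \<Rightarrow> 'a poly \<Rightarrow> 'a poly" (infixl \<open>\<diamondop>\<close> 70)
  where "p \<diamondop> q \<equiv> skew_mult \<sigma> p q"

lemma sigma_eq_iff [simp]: "\<sigma> a = \<sigma> b \<longleftrightarrow> a = b"
  using sigma_bij by (auto simp: bij_def inj_eq)

lemma sigma_0 [simp]: "\<sigma> 0 = 0"
  using sigma_add[of 0 0] by (simp only: add_0 add_cancel_right_right)

lemma sigma_eq_0_iff [simp]: "\<sigma> a = 0 \<longleftrightarrow> a = 0"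
  using sigma_eq_iff[of a 0] by (simp del: sigma_eq_iff)

lemma sigma_1 [simp]: "\<sigma> 1 = 1"
proof -
  have "\<sigma> 1 * \<sigma> 1 = \<sigma> 1"
    using sigma_mult[of 1 1] by (simp del: sigma_mult)
  then show ?thesis by simp
qed

lemma sigma_minus [simp]: "\<sigma> (- a) = - \<sigma> a"
  using sigma_add[of a "- a"] by (simp del: sigma_add add: eq_neg_iff_add_eq_0 add.commute)

lemma sigma_divide: "\<sigma> (a / b) = \<sigma> a / \<sigma> b"
proof (cases "b = 0")
  case False
  have "\<sigma> (a / b) * \<sigma> b = \<sigma> a"
    using False sigma_mult[of "a / b" b] by (simp del: sigma_mult)
  then show ?thesis using False by (simp add: field_simps)
qed simp

lemma skew_poly_funpow: "skew_poly (\<sigma> ^^ i)"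
proof
  show "(\<sigma> ^^ i) (a + b) = (\<sigma> ^^ i) a + (\<sigma> ^^ i) b" for a b by (induction i) auto
  show "(\<sigma> ^^ i) (a * b) = (\<sigma> ^^ i) a * (\<sigma> ^^ i) b" for a b by (induction i) auto
  show "bij (\<sigma> ^^ i)" using sigma_bij by (rule bij_fn)
qed

lemmas sigma_pow_add [simp] = skew_poly.sigma_add[OF skew_poly_funpow]
lemmas sigma_pow_mult [simp] = skew_poly.sigma_mult[OF skew_poly_funpow]
lemmas sigma_pow_0 [simp] = skew_poly.sigma_0[OF skew_poly_funpow]
lemmas sigma_pow_1 [simp] = skew_poly.sigma_1[OF skew_poly_funpow]
lemmas sigma_pow_eq_0_iff [simp] = skew_poly.sigma_eq_0_iff[OF skew_poly_funpow]

text \<open>The summation ranges in \<open>skew_mult\<close> depend on the degrees, which change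
  under addition. Padding with zero summands up to common bounds makes distributivity a termwise
  identity.\<close>

lemma skew_mult_cutoff:
  assumes "degree f \<le> N" "degree g \<le> M"
  shows "f \<diamondop> g = (\<Sum>i\<le>N. \<Sum>j\<le>M. monom (coeff f i * (\<sigma> ^^ i) (coeff g j)) (i + j))"
proof -
  have inner: "(\<Sum>j\<le>degree g. monom (coeff f i * (\<sigma> ^^ i) (coeff g j)) (i + j)) =
    (\<Sum>j\<le>M. monom (coeff f i * (\<sigma> ^^ i) (coeff g j)) (i + j))" for i
    by (rule sum.mono_neutral_left) (use assms(2) in \<open>auto simp: coeff_eq_0\<close>)
  have "f \<diamondop> g = (\<Sum>i\<le>degree f. \<Sum>j\<le>M. monom (coeff f i * (\<sigma> ^^ i) (coeff g j)) (i + j))"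
    by (simp add: skew_mult_def inner)
  also have "\<dots> = (\<Sum>i\<le>N. \<Sum>j\<le>M. monom (coeff f i * (\<sigma> ^^ i) (coeff g j)) (i + j))"
    by (rule sum.mono_neutral_left) (use assms(1) in \<open>auto simp: coeff_eq_0\<close>)
  finally show ?thesis .
qed

lemma skew_mult_add_left: "(f + g) \<diamondop> h = f \<diamondop> h + g \<diamondop> h"
proof -
  define N where "N = max (degree f) (degree g)"
  have d: "degree f \<le> N" "degree g \<le> N" "degree (f + g) \<le> N"
    using degree_add_le_max[of f g] by (auto simp: N_def)
  show ?thesis
    by (simp add: skew_mult_cutoff[OF d(1) order_refl] skew_mult_cutoff[OF d(2) order_refl]
        skew_mult_cutoff[OF d(3) order_refl] algebra_simps add_monom[symmetric] sum.distrib)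
qed

lemma skew_mult_add_right: "f \<diamondop> (g + h) = f \<diamondop> g + f \<diamondop> h"
proof -
  define N where "N = max (degree g) (degree h)"
  have d: "degree g \<le> N" "degree h \<le> N" "degree (g + h) \<le> N"
    using degree_add_le_max[of g h] by (auto simp: N_def)
  show ?thesis
    by (simp add: skew_mult_cutoff[OF order_refl d(1)] skew_mult_cutoff[OF order_refl d(2)]
        skew_mult_cutoff[OF order_refl d(3)] algebra_simps add_monom[symmetric] sum.distrib)
qed

lemma skew_mult_0_left [simp]: "0 \<diamondop> g = 0"
  using skew_mult_add_left[of 0 0 g] by (simp only: add_0 add_cancel_right_right)

lemma skew_mult_0_right [simp]: "f \<diamondop> 0 = 0"
  using skew_mult_add_right[of f 0 0] by (simp only: add_0 add_cancel_right_right)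

lemma skew_mult_minus_left: "(- f) \<diamondop> g = - (f \<diamondop> g)"
  using skew_mult_add_left[of f "- f" g] by (simp add: eq_neg_iff_add_eq_0 add.commute)

lemma skew_mult_minus_right: "f \<diamondop> (- g) = - (f \<diamondop> g)"
  using skew_mult_add_right[of f g "- g"] by (simp add: eq_neg_iff_add_eq_0 add.commute)

lemma skew_mult_diff_left: "(f - g) \<diamondop> h = f \<diamondop> h - g \<diamondop> h"
  using skew_mult_add_left[of f "- g" h] by (simp add: skew_mult_minus_left)

lemma skew_mult_diff_right: "f \<diamondop> (g - h) = f \<diamondop> g - f \<diamondop> h"
  using skew_mult_add_right[of f g "- h"] by (simp add: skew_mult_minus_right)

lemmas skew_distrib = skew_mult_add_left skew_mult_add_right skew_mult_diff_left
  skew_mult_diff_right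

lemma skew_mult_sum_left: "sum g I \<diamondop> h = (\<Sum>i\<in>I. g i \<diamondop> h)"
  by (induction I rule: infinite_finite_induct) (auto simp: skew_mult_add_left)

lemma skew_mult_sum_right: "h \<diamondop> sum g I = (\<Sum>i\<in>I. h \<diamondop> g i)"
  by (induction I rule: infinite_finite_induct) (auto simp: skew_mult_add_right)

lemma monom_mult_monom: "monom a i \<diamondop> monom b j = monom (a * (\<sigma> ^^ i) b) (i + j)"
proof -
  have d: "degree (monom a i) \<le> i" "degree (monom b j) \<le> j"
    by (auto intro: degree_monom_le)
  have "monom a i \<diamondop> monom b j =
    (\<Sum>k\<le>i. \<Sum>m\<le>j. monom ((if i = k then a else 0) * (\<sigma> ^^ k) (if j = m then b else 0)) (k + m))"
    by (simp add: skew_mult_cutoff[OF d])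
  also have "\<dots> = (\<Sum>k\<le>i. \<Sum>m\<le>j. if j = m then if i = k then monom (a * (\<sigma> ^^ i) b) (i + j) else 0 else 0)"
    by (intro sum.cong refl) auto
  finally show ?thesis by simp
qed

text \<open>Both sides are additive in each factor, so monomials suffice; there the claim reduces to
  \<open>\<sigma> ^^ (i + j)\<close> being the composite of the two powers.\<close>

lemma skew_mult_assoc: "(f \<diamondop> g) \<diamondop> h = f \<diamondop> (g \<diamondop> h)"
proof -
  have mmm: "(monom a i \<diamondop> monom b j) \<diamondop> monom c k = monom a i \<diamondop> (monom b j \<diamondop> monom c k)" for a b c i j k
    by (simp add: monom_mult_monom funpow_add mult.assoc add.assoc)
  have "(f \<diamondop> g) \<diamondop> h =
    ((\<Sum>i\<le>degree f. monom (coeff f i) i) \<diamondop> (\<Sum>j\<le>degree g. monom (coeff g j) j))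
      \<diamondop> (\<Sum>k\<le>degree h. monom (coeff h k) k)"
    by (simp only: poly_as_sum_of_monoms)
  also have "\<dots> = (\<Sum>i\<le>degree f. monom (coeff f i) i) \<diamondop>
     ((\<Sum>j\<le>degree g. monom (coeff g j) j) \<diamondop> (\<Sum>k\<le>degree h. monom (coeff h k) k))"
    by (simp add: skew_mult_sum_left skew_mult_sum_right mmm)
  also have "\<dots> = f \<diamondop> (g \<diamondop> h)"
    by (simp only: poly_as_sum_of_monoms)
  finally show ?thesis .
qed

section \<open>Coefficients and degrees of products\<close>

lemma coeff_monom_mult:
  "coeff (monom a i \<diamondop> g) k = (if i \<le> k then a * (\<sigma> ^^ i) (coeff g (k - i)) else 0)"
proof -
  have "monom a i \<diamondop> g = (\<Sum>j\<le>degree g. monom (a * (\<sigma> ^^ i) (coeff g j)) (i + j))"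
    using poly_as_sum_of_monoms[of g] skew_mult_sum_right[of "monom a i" "\<lambda>j. monom (coeff g j) j" "{..degree g}"]
    by (simp add: monom_mult_monom)
  then have "coeff (monom a i \<diamondop> g) k = (\<Sum>j\<le>degree g. if i + j = k then a * (\<sigma> ^^ i) (coeff g j) else 0)"
    by (simp add: coeff_sum)
  also have "\<dots> = (if i \<le> k then a * (\<sigma> ^^ i) (coeff g (k - i)) else 0)"
  proof (cases "i \<le> k")
    case True
    then have "i + j = k \<longleftrightarrow> j = k - i" for j by auto
    then show ?thesis using True by (auto simp: coeff_eq_0)
  qed (auto intro: sum.neutral)
  finally show ?thesis .
qed

lemma monom_0_mult: "monom a 0 \<diamondop> f = smult a f"
  by (rule poly_eqI) (simp add: coeff_monom_mult)

lemma skew_mult_1_left [simp]: "1 \<diamondop> f = f"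
  using monom_0_mult[of 1 f] by (simp add: monom_0 one_pCons)

lemma skew_mult_1_right [simp]: "f \<diamondop> 1 = f"
  by (simp add: skew_mult_def poly_as_sum_of_monoms)

lemma skew_mult_smult_left: "smult a f \<diamondop> g = smult a (f \<diamondop> g)"
  by (simp add: monom_0_mult[symmetric] skew_mult_assoc)

text \<open>All powers of \<open>\<sigma>\<close> fix \<open>a\<close>, so it commutes with every
  monomial. This gives linearity in the right factor over the fixed field.\<close>

lemma mult_monom_0_fixed:
  assumes "\<sigma> a = a" shows "f \<diamondop> monom a 0 = smult a f"
proof -
  have pow: "(\<sigma> ^^ i) a = a" for i using assms by (induction i) auto
  have "f \<diamondop> monom a 0 = (\<Sum>i\<le>degree f. monom (coeff f i) i \<diamondop> monom a 0)"
    by (simp add: skew_mult_sum_left[symmetric] poly_as_sum_of_monoms)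
  also have "\<dots> = (\<Sum>i\<le>degree f. monom a 0 \<diamondop> monom (coeff f i) i)"
    by (simp add: monom_mult_monom pow mult.commute)
  also have "\<dots> = monom a 0 \<diamondop> f"
    by (simp add: skew_mult_sum_right[symmetric] poly_as_sum_of_monoms)
  finally show ?thesis by (simp add: monom_0_mult)
qed

lemma skew_mult_smult_right:
  assumes "\<sigma> a = a" shows "f \<diamondop> smult a g = smult a (f \<diamondop> g)"
proof -
  have "f \<diamondop> smult a g = (f \<diamondop> monom a 0) \<diamondop> g"
    by (simp only: monom_0_mult skew_mult_assoc)
  then show ?thesis by (simp only: mult_monom_0_fixed[OF assms] skew_mult_smult_left)
qed

lemma coeff_mult_monom:
  "coeff (f \<diamondop> monom b j) k = (if j \<le> k then coeff f (k - j) * (\<sigma> ^^ (k - j)) b else 0)"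
proof -
  have "f \<diamondop> monom b j = (\<Sum>i\<le>degree f. monom (coeff f i * (\<sigma> ^^ i) b) (i + j))"
    using poly_as_sum_of_monoms[of f] skew_mult_sum_left[of "\<lambda>i. monom (coeff f i) i" "{..degree f}" "monom b j"]
    by (simp add: monom_mult_monom)
  then have "coeff (f \<diamondop> monom b j) k = (\<Sum>i\<le>degree f. if i + j = k then coeff f i * (\<sigma> ^^ i) b else 0)"
    by (simp add: coeff_sum)
  also have "\<dots> = (if j \<le> k then coeff f (k - j) * (\<sigma> ^^ (k - j)) b else 0)"
  proof (cases "j \<le> k")
    case True
    then have "i + j = k \<longleftrightarrow> i = k - j" for i by auto
    then show ?thesis using True by (auto simp: coeff_eq_0)
  qed (auto intro: sum.neutral)
  finally show ?thesis .
qed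

lemma coeff_skew_mult:
  "coeff (f \<diamondop> g) k = (\<Sum>i\<le>degree f. if i \<le> k then coeff f i * (\<sigma> ^^ i) (coeff g (k - i)) else 0)"
proof -
  have "f \<diamondop> g = (\<Sum>i\<le>degree f. monom (coeff f i) i \<diamondop> g)"
    by (simp add: skew_mult_sum_left[symmetric] poly_as_sum_of_monoms)
  then show ?thesis by (simp add: coeff_sum coeff_monom_mult)
qed

lemma coeff_skew_mult_0: "coeff (f \<diamondop> g) 0 = coeff f 0 * coeff g 0"
  by (simp add: coeff_skew_mult)

lemma degree_skew_mult_le: "degree (f \<diamondop> g) \<le> degree f + degree g"
  by (rule degree_le) (auto simp: coeff_skew_mult coeff_eq_0 intro!: sum.neutral)

lemma coeff_skew_mult_degree_add:
  "coeff (f \<diamondop> g) (degree f + degree g) = lead_coeff f * (\<sigma> ^^ degree f) (lead_coeff g)"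
proof -
  have "coeff (f \<diamondop> g) (degree f + degree g) =
    (\<Sum>i\<le>degree f. if i = degree f then coeff f i * (\<sigma> ^^ i) (lead_coeff g) else 0)"
    unfolding coeff_skew_mult by (rule sum.cong) (auto simp: coeff_eq_0)
  then show ?thesis by simp
qed

lemma degree_skew_mult:
  assumes "f \<noteq> 0" "g \<noteq> 0"
  shows "degree (f \<diamondop> g) = degree f + degree g"
proof (rule antisym[OF degree_skew_mult_le])
  show "degree f + degree g \<le> degree (f \<diamondop> g)"
    by (rule le_degree) (use assms in \<open>simp add: coeff_skew_mult_degree_add\<close>)
qed

lemma skew_mult_eq_0_iff [simp]: "f \<diamondop> g = 0 \<longleftrightarrow> f = 0 \<or> g = 0"
  using coeff_skew_mult_degree_add[of f g] by auto

lemma lead_coeff_skew_mult: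
  "lead_coeff (f \<diamondop> g) = lead_coeff f * (\<sigma> ^^ degree f) (lead_coeff g)"
  by (cases "f = 0 \<or> g = 0") (auto simp: degree_skew_mult coeff_skew_mult_degree_add)

text \<open>Division works because the leading coefficient of \<open>f\<close> stays invertible
  under powers of \<open>\<sigma>\<close>. The alternative \<open>r = 0\<close> covers constant
  \<open>f\<close>, since the zero polynomial has degree 0.\<close>

lemma skew_division:
  assumes "f \<noteq> 0"
  shows "\<exists>q r. g = q \<diamondop> f + r \<and> (r = 0 \<or> degree r < degree f)"
proof (induction "degree g" arbitrary: g rule: less_induct)
  case less
  show ?case
  proof (cases "g = 0 \<or> degree g < degree f")
    case True
    then show ?thesis by (intro exI[of _ 0] exI[of _ g]) auto
  next
    case False
    define i where "i = degree g - degree f"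
    \<comment> \<open>A left factor of degree \<open>i\<close> twists the leading coefficient of
      \<open>f\<close> by \<open>\<sigma> ^^ i\<close>; dividing by the twisted value makes the
      leading terms agree.\<close>
    define m where "m = monom (lead_coeff g / (\<sigma> ^^ i) (lead_coeff f)) i"
    define h where "h = g - m \<diamondop> f"
    have m: "degree m = i" "m \<noteq> 0"
      using assms False by (auto simp: m_def degree_monom_eq)
    have deg: "degree (m \<diamondop> f) = degree g"
      using m assms False by (simp add: degree_skew_mult i_def)
    have lead: "lead_coeff (m \<diamondop> f) = lead_coeff g"
      unfolding lead_coeff_skew_mult m using assms by (simp add: m_def degree_monom_eq)
    have "h = 0 \<or> degree h < degree g"
    proof (cases "degree g = 0")
      case True
      then have "degree h = 0"
        unfolding h_def using degree_diff_le_max[of g "m \<diamondop> f"] deg by simp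
      moreover have "coeff h 0 = 0"
        using lead True deg by (simp add: h_def)
      ultimately have "h = 0" by (metis leading_coeff_0_iff)
      then show ?thesis ..
    next
      case False
      have "degree h \<le> degree g"
        unfolding h_def using degree_diff_le_max[of g "m \<diamondop> f"] deg by simp
      moreover have "coeff h (degree g) = 0"
        using lead deg by (simp add: h_def)
      ultimately show ?thesis
        by (metis leading_coeff_0_iff le_neq_implies_less)
    qed
    then obtain q r where qr: "h = q \<diamondop> f + r" "r = 0 \<or> degree r < degree f"
    proof
      assume "h = 0"
      then show thesis using that[of 0 0] by simp
    next
      assume "degree h < degree g"
      then show thesis using less that by blast
    qed
    then have "g = (m + q) \<diamondop> f + r" by (simp add: h_def skew_distrib algebra_simps)
    then show ?thesis using qr(2) by blast
  qed
qed

lemma skew_ring_simps [simp]: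
  "carrier (skew_ring \<sigma>) = UNIV" "p \<otimes>\<^bsub>skew_ring \<sigma>\<^esub> q = p \<diamondop> q" "p \<oplus>\<^bsub>skew_ring \<sigma>\<^esub> q = p + q"
  "\<one>\<^bsub>skew_ring \<sigma>\<^esub> = 1" "\<zero>\<^bsub>skew_ring \<sigma>\<^esub> = 0"
  by (simp_all add: skew_ring_def)

lemma ring_skew_ring: "ring (skew_ring \<sigma>)"
proof (rule ringI)
  show "abelian_group (skew_ring \<sigma>)"
    by (rule abelian_groupI) (auto simp: add.assoc add.commute intro: exI[of _ "- x" for x])
  show "monoid (skew_ring \<sigma>)"
    by (rule monoidI) (auto simp: skew_mult_assoc)
qed (auto simp: skew_distrib)

lemma mem_cgenideal_iff: "p \<in> cgenideal (skew_ring \<sigma>) f \<longleftrightarrow> (\<exists>q. p = q \<diamondop> f)"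
  by (auto simp: cgenideal_def)

text \<open>Right division by a nonzero element of least degree in the left ideal
  \<open>Rb + Rf\<close> leaves remainder zero. That element is thus a greatest common right divisor
  with Bezout coefficients.\<close>

lemma left_ideal_sum_principal:
  assumes "f \<noteq> 0"
  obtains g p q where "g \<noteq> 0" "g = p \<diamondop> b + q \<diamondop> f" "\<exists>r. b = r \<diamondop> g" "\<exists>r. f = r \<diamondop> g"
proof -
  define I where "I = {p \<diamondop> b + q \<diamondop> f | p q. True}"
  have "f = 0 \<diamondop> b + 1 \<diamondop> f" "b = 1 \<diamondop> b + 0 \<diamondop> f" by simp_all
  then have fb: "f \<in> I" "b \<in> I" unfolding I_def by blast+
  define g where "g = arg_min degree (\<lambda>g. g \<in> I \<and> g \<noteq> 0)"
  have g: "g \<in> I \<and> g \<noteq> 0" unfolding g_def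
    by (rule arg_min_natI[of _ f]) (use assms fb in simp)
  have least: "degree g \<le> degree h" if "h \<in> I" "h \<noteq> 0" for h
    unfolding g_def by (rule arg_min_nat_le) (use that in simp)
  have "\<exists>r. h = r \<diamondop> g" if h: "h \<in> I" for h
  proof -
    obtain q r where qr: "h = q \<diamondop> g + r" "r = 0 \<or> degree r < degree g"
      using skew_division g by blast
    obtain p1 q1 where "h = p1 \<diamondop> b + q1 \<diamondop> f"
      using h by (auto simp: I_def)
    moreover obtain p2 q2 where "g = p2 \<diamondop> b + q2 \<diamondop> f"
      using g by (auto simp: I_def)
    ultimately have "r = (p1 - q \<diamondop> p2) \<diamondop> b + (q1 - q \<diamondop> q2) \<diamondop> f"
      using qr(1) by (simp add: skew_distrib skew_mult_assoc algebra_simps)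
    then have "r \<in> I" unfolding I_def by blast
    then have "r = 0" using qr(2) least by fastforce
    then show ?thesis using qr(1) by auto
  qed
  with fb g that show thesis unfolding I_def by blast
qed

end

section \<open>Linear algebra over a subfield\<close>

text \<open>A trivial kernel makes the image of a basis independent, and by its length it spans. The
  ambient ring is arbitrary, so that both the field and the polynomials of bounded degree are
  covered.\<close>

lemma (in ring) inj_linear_image_eq:
  assumes "subfield K R" "dimension n K E"
    and closed: "\<And>v. v \<in> E \<Longrightarrow> T v \<in> E"
    and add: "\<And>v w. v \<in> E \<Longrightarrow> w \<in> E \<Longrightarrow> T (v \<oplus> w) = T v \<oplus> T w"
    and smult: "\<And>k v. k \<in> K \<Longrightarrow> v \<in> E \<Longrightarrow> T (k \<otimes> v) = k \<otimes> T v"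
    and ker: "\<And>v. v \<in> E \<Longrightarrow> T v = \<zero> \<Longrightarrow> v = \<zero>"
  shows "T ` E = E"
proof -
  obtain Vs where Vs: "set Vs \<subseteq> carrier R" "independent K Vs" "length Vs = n" "Span K Vs = E"
    using exists_base[OF assms(1,2)] by blast
  have VsE: "set Vs \<subseteq> E" using Span_base_incl[OF assms(1) Vs(1)] Vs(4) by simp
  have E: "E \<subseteq> carrier R" "\<zero> \<in> E"
    using Span_subgroup_props[OF assms(1) Vs(1)] Vs(4) by auto
  have add_closed: "v \<oplus> w \<in> E" if "v \<in> E" "w \<in> E" for v w
    using Span_subgroup_props(3)[OF assms(1) Vs(1)] Vs(4) that by auto
  have smult_closed: "k \<otimes> v \<in> E" if "k \<in> K" "v \<in> E" for k v
    using Span_smult_closed[OF assms(1) Vs(1)] Vs(4) that by auto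
  have T0: "T \<zero> = \<zero>"
  proof -
    have "T \<zero> \<in> carrier R" using closed E by auto
    moreover have "T \<zero> \<oplus> T \<zero> = T \<zero>" using add[of \<zero> \<zero>] E by simp
    ultimately show ?thesis using local.add.r_cancel_one by blast
  qed
  have T_combine: "combine Ks Us \<in> E \<and> T (combine Ks Us) = combine Ks (map T Us)"
    if "set Ks \<subseteq> K" "set Us \<subseteq> E" for Ks Us
    using that by (induction Ks Us rule: combine.induct)
      (auto simp: T0 E add smult add_closed smult_closed)
  have TVs: "set (map T Vs) \<subseteq> E" using VsE closed by auto
  have "independent K (map T Vs)"
  proof (rule trivial_combine_imp_independent[OF assms(1)])
    show "set (map T Vs) \<subseteq> carrier R" using TVs E by auto
    fix Ks assume Ks: "set Ks \<subseteq> K" "combine Ks (map T Vs) = \<zero>"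
    then have "combine Ks Vs = \<zero>" using T_combine[OF Ks(1) VsE] ker by auto
    then show "set (take (length (map T Vs)) Ks) \<subseteq> {\<zero>}"
      using independent_imp_trivial_combine[OF assms(1) Vs(2) Ks(1)] by simp
  qed
  then have span: "Span K (map T Vs) = E"
    using independent_length_eq_dimension[OF assms(1,2) _ TVs] Vs(3) by simp
  have "e \<in> T ` E" if h: "e \<in> E" for e
  proof -
    have "set (map T Vs) \<subseteq> carrier R" using TVs E by auto
    then obtain Ks where "set Ks \<subseteq> K" "e = combine Ks (map T Vs)"
      using Span_mem_iff_length_version[OF assms(1), of "map T Vs" e] span h by (auto simp del: Span.simps)
    then show ?thesis using T_combine[OF _ VsE, of Ks] by (metis imageI)
  qed
  then show ?thesis using closed by auto
qed

section \<open>Subfields of the field carried by a type\<close>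

lemma type_ring_simps [simp]:
  "carrier ring_of_type_algebra = UNIV" "x \<otimes>\<^bsub>ring_of_type_algebra\<^esub> y = x * y"
  "x \<oplus>\<^bsub>ring_of_type_algebra\<^esub> y = x + y"
  "\<one>\<^bsub>ring_of_type_algebra\<^esub> = 1" "\<zero>\<^bsub>ring_of_type_algebra\<^esub> = 0"
  by (simp_all add: ring_of_type_algebra_def)

lemma a_inv_type_ring [simp]: "\<ominus>\<^bsub>ring_of_type_algebra\<^esub> x = - (x :: 'a::comm_ring_1)"
proof -
  interpret ring "ring_of_type_algebra :: 'a ring" by (rule ring_from_type_algebra)
  show ?thesis by (rule minus_equality) auto
qed

lemma subfield_closed:
  assumes "subfield F (fld :: 'a::field ring)"
  shows "0 \<in> F" "1 \<in> F" "a \<in> F \<Longrightarrow> - a \<in> F" "a \<in> F \<Longrightarrow> b \<in> F \<Longrightarrow> a + b \<in> F"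
    "a \<in> F \<Longrightarrow> b \<in> F \<Longrightarrow> a * b \<in> F"
    "a \<in> F \<Longrightarrow> b \<in> F \<Longrightarrow> a - b \<in> F" "(\<And>i. i \<in> I \<Longrightarrow> g i \<in> F) \<Longrightarrow> sum g I \<in> F"
proof -
  note sr = subringE[OF subfieldE(1)[OF assms]]
  show *: "0 \<in> F" "1 \<in> F" "a \<in> F \<Longrightarrow> - a \<in> F"
    and add: "\<And>a b. a \<in> F \<Longrightarrow> b \<in> F \<Longrightarrow> a + b \<in> F" "a \<in> F \<Longrightarrow> b \<in> F \<Longrightarrow> a * b \<in> F"
    using sr by auto
  show "a \<in> F \<Longrightarrow> b \<in> F \<Longrightarrow> a - b \<in> F" using sr(5)[of b] add(1)[of a "- b"] by simp
  show "(\<And>i. i \<in> I \<Longrightarrow> g i \<in> F) \<Longrightarrow> sum g I \<in> F"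
    by (induction I rule: infinite_finite_induct) (auto simp: * add)
qed

lemma subfield_fldI:
  assumes "0 \<in> F" "1 \<in> F" "\<And>a. a \<in> F \<Longrightarrow> - a \<in> F" "\<And>a b. a \<in> F \<Longrightarrow> b \<in> F \<Longrightarrow> a + b \<in> F"
    "\<And>a b. a \<in> F \<Longrightarrow> b \<in> F \<Longrightarrow> a * b \<in> F" "\<And>a. a \<in> F \<Longrightarrow> inverse a \<in> F"
  shows "subfield F (fld :: 'a::field ring)"
proof -
  interpret fld: field "fld :: 'a ring" by (rule field_from_type_algebra)
  have inv: "inv\<^bsub>fld\<^esub> a = inverse a" if "a \<noteq> 0" for a :: 'a
    by (rule fld.comm_inv_char) (use that in auto)
  show ?thesis
  proof (rule fld.subfieldI')
    show "subring F fld"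
      by (rule fld.subringI) (use assms in auto)
    show "\<And>k. k \<in> F - {\<zero>\<^bsub>fld\<^esub>} \<Longrightarrow> inv\<^bsub>fld\<^esub> k \<in> F"
      using assms(6) inv by auto
  qed
qed

lemma inverse_mem_subfield:
  assumes "subfield F (fld :: 'a::field ring)" "a \<in> F"
  shows "inverse a \<in> F"
proof (cases "a = 0")
  case False
  interpret fld: field "fld :: 'a ring" by (rule field_from_type_algebra)
  have "inv\<^bsub>fld\<^esub> a = inverse a"
    by (rule fld.comm_inv_char) (use False in auto)
  then show ?thesis using fld.subfield_m_inv(1)[OF assms(1), of a] assms(2) False by simp
qed (use assms subfield_closed(1) in simp)

section \<open>The norm as a determinant in a fixed basis\<close>

locale subfield_basis =
  fixes F :: "'a::field set" and bs :: "'a list"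
  assumes subfield: "subfield F fld"
    and independent: "ring.independent fld F bs"
    and span: "ring.Span fld F bs = UNIV"
begin

interpretation fld: field "fld :: 'a ring" by (rule field_from_type_algebra)

abbreviation "N \<equiv> length bs"

lemma combine_eq_sum:
  "length Ks = length Us \<Longrightarrow> fld.combine Ks Us = (\<Sum>i<length Us. Ks ! i * Us ! i)"
proof (induction Ks Us rule: fld.combine.induct)
  case (1 k Ks u Us)
  then show ?case by (simp add: sum.lessThan_Suc_shift del: sum.lessThan_Suc)
qed auto

lemma coordinates_unique:
  assumes "\<And>i. i < N \<Longrightarrow> c i \<in> F" "\<And>i. i < N \<Longrightarrow> c' i \<in> F"
    and "(\<Sum>i<N. c i * bs ! i) = (\<Sum>i<N. c' i * bs ! i)" "i < N"
  shows "c i = c' i"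
proof -
  define Ks where "Ks = map (\<lambda>i. c i - c' i) [0..<N]"
  have "fld.combine Ks bs = (\<Sum>i<N. (c i - c' i) * bs ! i)"
    by (subst combine_eq_sum) (auto simp: Ks_def)
  then have "fld.combine Ks bs = \<zero>\<^bsub>fld\<^esub>"
    using assms(3) by (simp add: left_diff_distrib sum_subtractf)
  moreover have "set Ks \<subseteq> F"
    using assms(1,2) by (auto simp: Ks_def intro!: subfield_closed(6)[OF subfield])
  ultimately have "set (take N Ks) \<subseteq> {0}"
    using fld.independent_imp_trivial_combine[OF subfield independent] by simp
  then show ?thesis using assms(4) by (auto simp: Ks_def image_subset_iff)
qed

lemma coordinates_exist: "\<exists>c. (\<forall>i<N. c i \<in> F) \<and> v = (\<Sum>i<N. c i * bs ! i)"
proof -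
  have "v \<in> fld.Span F bs" using span by simp
  then obtain Ks where Ks: "set Ks \<subseteq> F" "length Ks = N" "v = fld.combine Ks bs"
    using fld.Span_mem_iff_length_version[OF subfield, of bs v] by auto
  then show ?thesis
    by (intro exI[of _ "\<lambda>i. Ks ! i"]) (auto simp: combine_eq_sum)
qed

definition represents :: "'a mat \<Rightarrow> ('a \<Rightarrow> 'a) \<Rightarrow> bool" where
  "represents M T \<longleftrightarrow> M \<in> carrier_mat N N \<and> (\<forall>i<N. \<forall>j<N. M $$ (i, j) \<in> F) \<and>
     (\<forall>j<N. T (bs ! j) = (\<Sum>i<N. M $$ (i, j) * bs ! i))"

lemma represents_exists: "\<exists>M. represents M T"
proof -
  obtain c where c: "\<And>v i. i < N \<Longrightarrow> c v i \<in> F" "\<And>v. v = (\<Sum>i<N. c v i * bs ! i)"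
    using coordinates_exist by metis
  have "represents (mat N N (\<lambda>(i, j). c (T (bs ! j)) i)) T"
    using c by (auto simp: represents_def)
  then show ?thesis ..
qed

lemma represents_unique: "represents M T \<Longrightarrow> represents M' T \<Longrightarrow> M = M'"
  by (rule eq_matI)
    (auto simp: represents_def intro!: coordinates_unique[of "\<lambda>i. M $$ (i, j)" "\<lambda>i. M' $$ (i, j)" for j])

definition linear_map :: "('a \<Rightarrow> 'a) \<Rightarrow> bool" where
  "linear_map T \<longleftrightarrow> (\<forall>a b. T (a + b) = T a + T b) \<and> (\<forall>k\<in>F. \<forall>a. T (k * a) = k * T a)"

lemma linear_map_sum:
  assumes "linear_map T" "finite I" "\<And>i. i \<in> I \<Longrightarrow> k i \<in> F"
  shows "T (\<Sum>i\<in>I. k i * v i) = (\<Sum>i\<in>I. k i * T (v i))"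
proof -
  have add: "T (a + b) = T a + T b" for a b using assms(1) by (simp add: linear_map_def)
  have "T 0 = 0" using add[of 0 0] by (simp only: add_0 add_cancel_right_right)
  with assms(2,3) show ?thesis
    by (induction I rule: finite_induct) (use assms(1) in \<open>auto simp: linear_map_def\<close>)
qed

text \<open>A matrix records values on the basis only; linearity of the outer map carries it through
  the coordinates of \<open>S (bs ! j)\<close>.\<close>

lemma represents_comp:
  assumes "linear_map T" "represents M T" "represents M' S"
  shows "represents (M * M') (T \<circ> S)"
proof -
  have M: "M \<in> carrier_mat N N" "M' \<in> carrier_mat N N" "\<And>i j. i < N \<Longrightarrow> j < N \<Longrightarrow> M $$ (i, j) \<in> F"
    "\<And>i j. i < N \<Longrightarrow> j < N \<Longrightarrow> M' $$ (i, j) \<in> F"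
    "\<And>j. j < N \<Longrightarrow> T (bs ! j) = (\<Sum>i<N. M $$ (i, j) * bs ! i)"
    "\<And>j. j < N \<Longrightarrow> S (bs ! j) = (\<Sum>i<N. M' $$ (i, j) * bs ! i)"
    using assms(2,3) by (auto simp: represents_def)
  have entry: "(M * M') $$ (i, j) = (\<Sum>k<N. M $$ (i, k) * M' $$ (k, j))" if "i < N" "j < N" for i j
    using M(1,2) that by (auto simp: scalar_prod_def lessThan_atLeast0 intro!: sum.cong)
  have "T (S (bs ! j)) = (\<Sum>i<N. (M * M') $$ (i, j) * bs ! i)" if j: "j < N" for j
  proof -
    have "T (S (bs ! j)) = (\<Sum>k<N. M' $$ (k, j) * T (bs ! k))"
      unfolding M(6)[OF j] by (rule linear_map_sum[OF assms(1)]) (use M(4) j in auto)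
    also have "\<dots> = (\<Sum>k<N. \<Sum>i<N. M $$ (i, k) * M' $$ (k, j) * bs ! i)"
      by (intro sum.cong refl) (simp add: M(5) sum_distrib_left mult_ac)
    also have "\<dots> = (\<Sum>i<N. \<Sum>k<N. M $$ (i, k) * M' $$ (k, j) * bs ! i)"
      by (rule sum.swap)
    also have "\<dots> = (\<Sum>i<N. (M * M') $$ (i, j) * bs ! i)"
      by (intro sum.cong refl) (simp add: entry j sum_distrib_right)
    finally show ?thesis .
  qed
  moreover have "(M * M') $$ (i, j) \<in> F" if "i < N" "j < N" for i j
    using M(3,4) that by (auto simp: entry intro!: subfield_closed[OF subfield])
  ultimately show ?thesis using M(1,2) by (auto simp: represents_def)
qed

lemma represents_id: "represents (1\<^sub>m N) id"
  by (auto simp: represents_def subfield_closed[OF subfield] if_distrib if_distribR cong: if_cong)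

text \<open>The choice is harmless by \<open>represents_unique\<close>. A possible dependence on the
  basis is dealt with in \<open>field_norm_eqI\<close>.\<close>

definition bnorm :: "'a \<Rightarrow> 'a" where
  "bnorm a = det (SOME M. represents M ((*) a))"

lemma bnorm_eq: "represents M ((*) a) \<Longrightarrow> bnorm a = det M"
  unfolding bnorm_def using someI[of "\<lambda>M. represents M ((*) a)" M] represents_unique by metis

lemma linear_map_times: "linear_map ((*) a)"
  by (simp add: linear_map_def algebra_simps)

lemma represents_carrier: "represents M T \<Longrightarrow> M \<in> carrier_mat N N"
  by (simp add: represents_def)

lemma bnorm_1: "bnorm 1 = 1"
proof -
  have "(*) (1::'a) = id" by auto
  then show ?thesis using bnorm_eq[of "1\<^sub>m N" 1] represents_id by simp
qed

lemma bnorm_mult: "bnorm (a * b) = bnorm a * bnorm b"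
proof -
  obtain M M' where M: "represents M ((*) a)" "represents M' ((*) b)"
    using represents_exists by blast
  have "(*) a \<circ> (*) b = (*) (a * b)" by (auto simp: mult.assoc)
  then have "represents (M * M') ((*) (a * b))"
    using represents_comp[OF linear_map_times M] by simp
  then show ?thesis
    using M by (simp add: bnorm_eq det_mult[OF represents_carrier represents_carrier])
qed

lemma bnorm_nonzero: "a \<noteq> 0 \<Longrightarrow> bnorm a \<noteq> 0"
  using bnorm_mult[of a "inverse a"] bnorm_1 by auto

text \<open>Multiplication by \<open>\<tau> a\<close> is the conjugate of multiplication by \<open>a\<close> under the linear map \<open>\<tau>\<close>.\<close>
lemma bnorm_automorphism:
  assumes "bij \<tau>" "\<And>a b. \<tau> (a + b) = \<tau> a + \<tau> b" "\<And>a b. \<tau> (a * b) = \<tau> a * \<tau> b"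
    and "\<And>a. a \<in> F \<Longrightarrow> \<tau> a = a"
  shows "bnorm (\<tau> a) = bnorm a"
proof -
  have lin: "linear_map \<tau>" using assms by (simp add: linear_map_def)
  have surj: "\<tau> (inv_into UNIV \<tau> x) = x" for x using assms(1) by (simp add: bij_is_surj surj_f_inv_f)
  have inj: "\<tau> x = \<tau> y \<Longrightarrow> x = y" for x y using assms(1) by (simp add: bij_is_inj inj_eq)
  \<comment> \<open>Every map has a matrix of values on the basis, so the inverse of
    \<open>\<tau>\<close> gets one directly.\<close>
  obtain M P Q where M: "represents M ((*) a)" and P: "represents P \<tau>" and Q: "represents Q (inv_into UNIV \<tau>)"
    using represents_exists by blast
  obtain M' where M': "represents M' ((*) (\<tau> a))"
    using represents_exists by blast
  have "\<tau> \<circ> inv_into UNIV \<tau> = id" by (auto simp: surj)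
  then have "represents (P * Q) id" using represents_comp[OF lin P Q] by simp
  then have "det (P * Q) = 1" using represents_unique[OF _ represents_id] by force
  then have det_P: "det P \<noteq> 0"
    using det_mult[OF represents_carrier[OF P] represents_carrier[OF Q]] by auto
  have "\<tau> \<circ> (*) a = (*) (\<tau> a) \<circ> \<tau>" by (auto simp: assms(3))
  then have "P * M = M' * P"
    using represents_comp[OF lin P M] represents_comp[OF linear_map_times M' P]
    by (metis represents_unique)
  then have "det P * det M = det M' * det P"
    using det_mult[OF represents_carrier[OF P] represents_carrier[OF M]]
      det_mult[OF represents_carrier[OF M'] represents_carrier[OF P]] by metis
  then show ?thesis using det_P M M' by (simp add: bnorm_eq)
qed

end

text \<open>\<open>field_norm\<close> is a definite description ranging over all bases. A finite
  basis gives existence, and the same value \<open>d\<close> in every basis gives uniqueness, which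
  replaces a change-of-basis argument.\<close>

lemma field_norm_eqI:
  assumes "subfield F fld" "ring.finite_dimension fld F UNIV"
    and "\<And>bs. subfield_basis F bs \<Longrightarrow> subfield_basis.bnorm F bs a = d"
  shows "field_norm F a = d"
  unfolding field_norm_def
proof (rule the_equality)
  interpret fld: field "fld :: 'a ring" by (rule field_from_type_algebra)
  obtain m where "fld.dimension m F UNIV"
    using assms(2) by (auto simp: fld.finite_dimension_def)
  then obtain bs where bs: "fld.independent F bs" "fld.Span F bs = UNIV"
    using fld.exists_base[OF assms(1)] by blast
  then interpret subfield_basis F bs using assms(1) by (simp add: subfield_basis_def)
  obtain M where "represents M ((*) a)" using represents_exists by blast
  moreover from this have "d = det M"
    using bnorm_eq assms(3)[OF subfield_basis_axioms] by simp
  ultimately show "\<exists>bs M. fld.independent F bs \<and> fld.Span F bs = UNIV \<and>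
     M \<in> carrier_mat (length bs) (length bs) \<and>
     (\<forall>i<length bs. \<forall>j<length bs. M $$ (i, j) \<in> F) \<and>
     (\<forall>j<length bs. a * bs ! j = (\<Sum>i<length bs. M $$ (i, j) * bs ! i)) \<and>
     d = det M"
    using bs by (auto simp: represents_def)
next
  interpret fld: field "fld :: 'a ring" by (rule field_from_type_algebra)
  fix d' assume "\<exists>bs M. fld.independent F bs \<and> fld.Span F bs = UNIV \<and>
     M \<in> carrier_mat (length bs) (length bs) \<and>
     (\<forall>i<length bs. \<forall>j<length bs. M $$ (i, j) \<in> F) \<and>
     (\<forall>j<length bs. a * bs ! j = (\<Sum>i<length bs. M $$ (i, j) * bs ! i)) \<and>
     d' = det M"
  then obtain bs M where bs: "fld.independent F bs" "fld.Span F bs = UNIV"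
    and M: "M \<in> carrier_mat (length bs) (length bs)"
     "\<forall>i<length bs. \<forall>j<length bs. M $$ (i, j) \<in> F"
     "\<forall>j<length bs. a * bs ! j = (\<Sum>i<length bs. M $$ (i, j) * bs ! i)" "d' = det M"
    by blast
  from bs interpret subfield_basis F bs using assms(1) by (simp add: subfield_basis_def)
  have "represents M ((*) a)" using M by (simp add: represents_def)
  then show "d' = d" using bnorm_eq assms(3)[OF subfield_basis_axioms] M(4) by simp
qed

text \<open>Dimension is taken inside a single ring, so scalars are embedded as constant
  polynomials; the commutative product of polynomials serves only to scale.\<close>

lemma finite_dimension_degree_less:
  fixes F :: "'a::field set" and d :: nat
  defines "FC \<equiv> (\<lambda>k. [:k:]) ` F" and "V \<equiv> {p. degree p < d}"
  assumes "subfield F fld" "ring.finite_dimension fld F UNIV" "d > 0"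
  shows "subfield FC (ring_of_type_algebra :: 'a poly ring)"
    and "ring.finite_dimension (ring_of_type_algebra :: 'a poly ring) FC V"
proof -
  let ?P = "ring_of_type_algebra :: 'a poly ring"
  interpret fld: field "fld :: 'a ring" by (rule field_from_type_algebra)
  interpret P: ring ?P by (rule ring_from_type_algebra)
  interpret hom: ring_hom_ring "fld :: 'a ring" ?P "\<lambda>k. [:k:]"
    by (rule ring_hom_ringI) (auto simp: fld.ring_axioms P.ring_axioms one_pCons)
  show FC: "subfield FC ?P"
    unfolding FC_def using assms(3) by (rule hom.img_is_subfield(2)) simp
  obtain m where "fld.dimension m F UNIV"
    using assms(4) by (auto simp: fld.finite_dimension_def)
  then obtain bs where bs: "fld.independent F bs" "fld.Span F bs = UNIV"
    using fld.exists_base[OF assms(3)] by blast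
  then interpret subfield_basis F bs using assms(3) by (simp add: subfield_basis_def)
  \<comment> \<open>The products of basis elements with the powers of \<open>x\<close> below
    \<open>d\<close> span \<open>V\<close> over the constants from \<open>F\<close>.\<close>
  define Us where "Us = concat (map (\<lambda>i. map (\<lambda>b. monom b i) bs) [0..<d])"
  have Us: "set Us \<subseteq> carrier ?P" by simp
  note span_props = P.Span_subgroup_props[OF FC Us] P.Span_smult_closed[OF FC Us]
  have sum_Span: "(\<And>i. i \<in> I \<Longrightarrow> g i \<in> P.Span FC Us) \<Longrightarrow> sum g I \<in> P.Span FC Us" for g and I :: "nat set"
    using span_props(2,3) by (induction I rule: infinite_finite_induct) (auto simp del: P.Span.simps)
  have monom_Span: "monom a i \<in> P.Span FC Us" if "i < d" for a i
  proof -
    obtain c where c: "\<forall>j<length bs. c j \<in> F" "a = (\<Sum>j<length bs. c j * bs ! j)"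
      using coordinates_exist by blast
    have "[:c j:] * monom (bs ! j) i \<in> P.Span FC Us" if "j < length bs" for j
    proof -
      have "monom (bs ! j) i \<in> set Us" using that \<open>i < d\<close> by (force simp: Us_def)
      then have "monom (bs ! j) i \<in> P.Span FC Us" using P.Span_base_incl[OF FC Us] by blast
      then show ?thesis
        using span_props(5)[of "[:c j:]" "monom (bs ! j) i"] c(1) that by (simp add: FC_def del: P.Span.simps)
    qed
    then have "(\<Sum>j<length bs. [:c j:] * monom (bs ! j) i) \<in> P.Span FC Us"
      by (intro sum_Span) auto
    moreover have "(\<Sum>j<length bs. [:c j:] * monom (bs ! j) i) = monom a i"
      by (rule poly_eqI) (simp add: c(2) smult_monom coeff_sum sum.delta)
    ultimately show ?thesis by simp
  qed
  have "V \<subseteq> P.Span FC Us"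
  proof
    fix p assume "p \<in> V"
    then have "(\<Sum>i\<le>degree p. monom (coeff p i) i) \<in> P.Span FC Us"
      by (intro sum_Span monom_Span) (simp add: V_def)
    then show "p \<in> P.Span FC Us" by (simp only: poly_as_sum_of_monoms)
  qed
  moreover have "subalgebra FC V ?P"
  proof (rule subalgebra.intro)
    show "subgroup V (add_monoid ?P)"
    proof (rule P.add.subgroupI)
      show "V \<noteq> {}" using assms(5) by (auto simp: V_def intro!: exI[of _ 0])
    qed (use degree_add_less in \<open>auto simp: V_def a_inv_def[symmetric]\<close>)
    show "subalgebra_axioms FC V ?P"
      by (auto simp: subalgebra_axioms_def FC_def V_def intro: le_less_trans[OF degree_smult_le])
  qed
  ultimately show "P.finite_dimension FC V"
    using P.subalbegra_incl_imp_finite_dimension[OF FC P.Span_finite_dimension[OF FC Us]] by blast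
qed

lemma inj_linear_surj_poly:
  fixes F :: "'a::field set"
  assumes "subfield F fld" "ring.finite_dimension fld F UNIV" "d > 0"
    and "\<And>p. degree p < d \<Longrightarrow> degree (T p) < d"
    and "\<And>p q. degree p < d \<Longrightarrow> degree q < d \<Longrightarrow> T (p + q) = T p + T q"
    and "\<And>k p. k \<in> F \<Longrightarrow> degree p < d \<Longrightarrow> T (smult k p) = smult k (T p)"
    and "\<And>p. degree p < d \<Longrightarrow> T p = 0 \<Longrightarrow> p = 0"
  shows "T ` {p. degree p < d} = {p. degree p < d}"
proof -
  interpret P: ring "ring_of_type_algebra :: 'a poly ring" by (rule ring_from_type_algebra)
  note fin = finite_dimension_degree_less[OF assms(1-3)]
  obtain m where "P.dimension m ((\<lambda>k. [:k:]) ` F) {p. degree p < d}"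
    using fin(2) by (auto simp: P.finite_dimension_def)
  then show ?thesis
    by (rule P.inj_linear_image_eq[OF fin(1)]) (use assms(4-7) in auto)
qed

lemma inj_linear_surj_field:
  fixes F :: "'a::field set"
  assumes "subfield F fld" "ring.finite_dimension fld F UNIV"
    and "\<And>a b. T (a + b) = T a + T b" "\<And>k a. k \<in> F \<Longrightarrow> T (k * a) = k * T a" "\<And>a. T a = 0 \<Longrightarrow> a = 0"
  shows "surj T"
proof -
  interpret fld: field "fld :: 'a ring" by (rule field_from_type_algebra)
  obtain m where "fld.dimension m F UNIV"
    using assms(2) by (auto simp: fld.finite_dimension_def)
  then show ?thesis
    by (rule fld.inj_linear_image_eq[OF assms(1)]) (use assms(3-5) in auto)
qed

section \<open>The module \<open>R/Rf\<close>\<close>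

locale skew_quotient = skew_poly \<sigma> for \<sigma> :: "'a::field \<Rightarrow> 'a" +
  fixes f :: "'a poly"
  assumes degree_f: "degree f > 0" and monic_f: "lead_coeff f = 1"
begin

definition Rf :: "'a poly set" where "Rf = cgenideal (skew_ring \<sigma>) f"

abbreviation md :: "'a poly \<Rightarrow> 'a poly" where "md p \<equiv> mod_r \<sigma> p f"

abbreviation "d \<equiv> degree f"

lemma f_nonzero [simp]: "f \<noteq> 0"
  using degree_f by auto

lemma mem_Rf_iff: "p \<in> Rf \<longleftrightarrow> (\<exists>q. p = q \<diamondop> f)"
  by (simp add: Rf_def mem_cgenideal_iff)

lemma f_Rf [simp]: "f \<in> Rf"
  unfolding mem_Rf_iff by (rule exI[of _ 1]) simp

lemma zero_Rf [simp]: "0 \<in> Rf"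
  unfolding mem_Rf_iff by (rule exI[of _ 0]) simp

lemma add_Rf: "p \<in> Rf \<Longrightarrow> q \<in> Rf \<Longrightarrow> p + q \<in> Rf"
  unfolding mem_Rf_iff by (metis skew_mult_add_left)

lemma uminus_Rf_iff [simp]: "- p \<in> Rf \<longleftrightarrow> p \<in> Rf"
  unfolding mem_Rf_iff by (metis minus_minus skew_mult_minus_left)

lemma diff_Rf: "p \<in> Rf \<Longrightarrow> q \<in> Rf \<Longrightarrow> p - q \<in> Rf"
  unfolding mem_Rf_iff by (metis skew_mult_diff_left)

lemma mult_Rf: "p \<in> Rf \<Longrightarrow> r \<diamondop> p \<in> Rf"
  unfolding mem_Rf_iff by (metis skew_mult_assoc)

lemma smult_Rf: "p \<in> Rf \<Longrightarrow> smult a p \<in> Rf"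
  using mult_Rf[of p "monom a 0"] by (simp add: monom_0_mult)

lemma Rf_diff_iff: "p - q \<in> Rf \<Longrightarrow> p \<in> Rf \<longleftrightarrow> q \<in> Rf"
  using add_Rf[of "p - q" q] diff_Rf[of p "p - q"] by auto

lemma Rf_sym: "p - q \<in> Rf \<Longrightarrow> q - p \<in> Rf"
  by (metis minus_diff_eq uminus_Rf_iff)

lemma Rf_small: "p \<in> Rf \<Longrightarrow> degree p < d \<Longrightarrow> p = 0"
  unfolding mem_Rf_iff using degree_skew_mult[OF _ f_nonzero] by force

lemma md_unique_ex: "\<exists>!r. degree r < d \<and> p - r \<in> Rf"
proof (rule ex_ex1I)
  obtain q r where "p = q \<diamondop> f + r" "r = 0 \<or> degree r < d"
    using skew_division[OF f_nonzero] by blast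
  then have "degree r < d \<and> p - r \<in> Rf" using degree_f by (auto simp: mem_Rf_iff)
  then show "\<exists>r. degree r < d \<and> p - r \<in> Rf" ..
next
  fix r r' assume r: "degree r < d \<and> p - r \<in> Rf" "degree r' < d \<and> p - r' \<in> Rf"
  then have "(p - r') - (p - r) \<in> Rf" using diff_Rf by blast
  moreover have "degree (r - r') < d" using r degree_diff_less by blast
  ultimately show "r = r'" using Rf_small by fastforce
qed

lemma degree_md [simp]: "degree (md p) < d"
  and diff_md_Rf: "p - md p \<in> Rf"
  using theI'[OF md_unique_ex[of p]] by (simp_all add: mod_r_def Rf_def)

lemma md_eqI: "degree r < d \<Longrightarrow> p - r \<in> Rf \<Longrightarrow> md p = r"
  using md_unique_ex[of p] degree_md[of p] diff_md_Rf[of p] by blast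

lemma md_eq_iff: "md p = md q \<longleftrightarrow> p - q \<in> Rf"
proof
  assume "md p = md q"
  then show "p - q \<in> Rf" using diff_Rf[OF diff_md_Rf[of p] diff_md_Rf[of q]] by simp
next
  assume "p - q \<in> Rf"
  then show "md p = md q"
    using md_eqI[of "md q" p] add_Rf[OF _ diff_md_Rf[of q], of "p - q"] by simp
qed

lemma md_small [simp]: "degree p < d \<Longrightarrow> md p = p"
  by (rule md_eqI) auto

lemma md_0 [simp]: "md 0 = 0"
  using degree_f by simp

lemma md_eq_0_iff: "md p = 0 \<longleftrightarrow> p \<in> Rf"
  using md_eq_iff[of p 0] by simp

lemma md_add: "md (p + q) = md p + md q"
proof (rule md_eqI)
  show "degree (md p + md q) < d" by (simp add: degree_add_less)
  show "p + q - (md p + md q) \<in> Rf"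
    using add_Rf[OF diff_md_Rf[of p] diff_md_Rf[of q]] by (simp add: algebra_simps)
qed

lemma md_smult: "md (smult a p) = smult a (md p)"
proof (rule md_eqI)
  show "degree (smult a (md p)) < d" by (rule le_less_trans[OF degree_smult_le]) simp
  show "smult a p - smult a (md p) \<in> Rf"
    using smult_Rf[OF diff_md_Rf[of p], of a] by (simp add: smult_diff_right)
qed

lemma md_sum: "md (sum g I) = (\<Sum>i\<in>I. md (g i))"
  by (induction I rule: infinite_finite_induct) (auto simp: md_add)

text \<open>\<open>Rf\<close> is a left ideal, so the right factor may be reduced freely; reducing
  the left factor needs a condition as in \<open>E_cong\<close>.\<close>

lemma md_mult: "md (p \<diamondop> md q) = md (p \<diamondop> q)"
  unfolding md_eq_iff using mult_Rf[OF Rf_sym[OF diff_md_Rf[of q]], of p]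
  by (simp add: skew_distrib)

text \<open>Remainders are linear over left constants, so the remainders of the
  \<open>monom 1 i \<diamondop> b\<close> determine those of all \<open>p \<diamondop> b\<close>.
  The bound \<open>m\<close> may reach \<open>d\<close>, as needed for a relation of degree
  \<open>d\<close>.\<close>

lemma coeff_md_mult:
  assumes "degree p \<le> m"
  shows "coeff (md (p \<diamondop> b)) k = (\<Sum>i\<le>m. coeff p i * coeff (md (monom 1 i \<diamondop> b)) k)"
proof -
  have "p = (\<Sum>i\<le>m. monom (coeff p i) i)"
    using poly_as_sum_of_monoms'[OF assms] by simp
  then have "p \<diamondop> b = (\<Sum>i\<le>m. monom (coeff p i) i \<diamondop> b)"
    by (metis skew_mult_sum_left)
  also have "\<dots> = (\<Sum>i\<le>m. smult (coeff p i) (monom 1 i \<diamondop> b))"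
    by (simp add: skew_mult_smult_left[symmetric] smult_monom)
  finally show ?thesis by (simp add: md_sum md_smult coeff_sum)
qed

lemma coeff_md_mult_small:
  assumes "degree p < d"
  shows "coeff (md (p \<diamondop> b)) k = (\<Sum>i<d. coeff p i * coeff (md (monom 1 i \<diamondop> b)) k)"
proof -
  have "{..d - 1} = {..<d}" using degree_f by auto
  then show ?thesis using coeff_md_mult[of p "d - 1" b k] assms by simp
qed

end

text \<open>On coordinate rows, left multiplication by \<open>x\<close> on \<open>R/Rh\<close>, for \<open>h\<close> monic of degree \<open>m\<close>, is \<open>\<sigma>\<close> in each
  coordinate followed by the companion matrix.\<close>
definition companion :: "'a::field poly \<Rightarrow> nat \<Rightarrow> 'a mat" where
  "companion h m = mat m m (\<lambda>(i, j). if i = m - 1 then - coeff h j else if j = i + 1 then 1 else 0)"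

text \<open>In the first column only the last entry can be nonzero, and deleting its row and column
  leaves the identity matrix.\<close>

lemma det_companion:
  assumes "m > 0"
  shows "det (companion h m) = - coeff h 0 * (- 1) ^ (m - 1)"
proof -
  let ?C = "companion h m"
  have C: "?C \<in> carrier_mat m m" by (simp add: companion_def)
  have del: "mat_delete ?C (m - 1) 0 = 1\<^sub>m (m - 1)"
    by (rule eq_matI) (auto simp: mat_delete_def companion_def)
  have "det ?C = (\<Sum>i<m. ?C $$ (i, 0) * cofactor ?C i 0)"
    by (rule laplace_expansion_column[OF C]) (use assms in simp)
  also have "\<dots> = (\<Sum>i<m. if i = m - 1 then - coeff h 0 * (- 1) ^ (m - 1) else 0)"
  proof (intro sum.cong refl)
    fix i assume "i \<in> {..<m}"
    then have "?C $$ (i, 0) = (if i = m - 1 then - coeff h 0 else 0)" by (simp add: companion_def)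
    then show "?C $$ (i, 0) * cofactor ?C i 0 =
        (if i = m - 1 then - coeff h 0 * (- 1) ^ (m - 1) else 0)"
      using del by (simp add: cofactor_def)
  qed
  also have "\<dots> = - coeff h 0 * (- 1) ^ (m - 1)" using assms by simp
  finally show ?thesis .
qed

context skew_quotient
begin

lemma sigma_comm_ring_hom: "comm_ring_hom \<sigma>"
  by unfold_locales auto

text \<open>Multiplying by \<open>x\<close> moves \<open>coeff r j\<close> to
  \<open>\<sigma> (coeff r j)\<close> in degree \<open>j + 1\<close>. Row \<open>j\<close> of the
  matrix is the remainder of that power of \<open>x\<close>: the power itself, or
  \<open>monom 1 d - f\<close> in the last row.\<close>

lemma companion_x:
  assumes "degree r < d" "k < d"
  shows "coeff (md (monom 1 1 \<diamondop> r)) k = (\<Sum>j<d. \<sigma> (coeff r j) * companion f d $$ (j, k))"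
proof -
  have row: "coeff (md (monom 1 (j + 1))) k = companion f d $$ (j, k)" if "j < d" for j
  proof (cases "j = d - 1")
    case True
    have "degree (monom 1 d - f) < d"
    proof -
      have "degree (monom 1 d - f) \<le> d" by (intro degree_diff_le degree_monom_le) auto
      moreover have "coeff (monom 1 d - f) d = 0" using monic_f by simp
      ultimately show ?thesis
        using degree_f by (metis leading_coeff_0_iff degree_0 le_neq_implies_less)
    qed
    then have "md (monom 1 d) = monom 1 d - f" by (rule md_eqI) simp
    then show ?thesis using True assms degree_f by (simp add: companion_def)
  next
    case False
    then have "degree (monom (1::'a) (j + 1)) < d" using that by (simp add: degree_monom_eq)
    then have "md (monom 1 (j + 1)) = monom 1 (j + 1)" by (rule md_small)
    then show ?thesis using False assms that by (auto simp: companion_def)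
  qed
  have "degree (monom 1 1 \<diamondop> r) \<le> d"
    using degree_skew_mult_le[of "monom 1 1" r] assms by (simp add: degree_monom_eq)
  then have "coeff (md (monom 1 1 \<diamondop> r)) k =
      (\<Sum>i\<le>d. coeff (monom 1 1 \<diamondop> r) i * coeff (md (monom 1 i)) k)"
    using coeff_md_mult[of "monom 1 1 \<diamondop> r" d 1 k] by simp
  also have "\<dots> = (\<Sum>j<d. coeff (monom 1 1 \<diamondop> r) (Suc j) * coeff (md (monom 1 (Suc j))) k)"
    by (subst sum.atMost_shift) (simp add: coeff_monom_mult)
  also have "\<dots> = (\<Sum>j<d. \<sigma> (coeff r j) * companion f d $$ (j, k))"
    using row by (intro sum.cong refl) (simp add: coeff_monom_mult)
  finally show ?thesis .
qed

text \<open>\<open>Rb + Rf\<close> is generated by a right divisor \<open>e\<close> of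
  \<open>f\<close>. A unit cofactor would put \<open>b\<close> into \<open>Rf\<close>, so
  irreducibility makes \<open>e\<close> a unit: the module \<open>R/Rf\<close> is simple.\<close>

lemma generates_quotient:
  assumes "irreducible_elt (skew_ring \<sigma>) f" "b \<notin> Rf"
  obtains p where "p \<diamondop> b - 1 \<in> Rf"
proof -
  obtain e p q where e: "e \<noteq> 0" "e = p \<diamondop> b + q \<diamondop> f" "\<exists>r. b = r \<diamondop> e" "\<exists>r. f = r \<diamondop> e"
    by (rule left_ideal_sum_principal[OF f_nonzero])
  then obtain r s where rs: "b = r \<diamondop> e" "f = s \<diamondop> e" by blast
  have "s \<in> Units (skew_ring \<sigma>) \<or> e \<in> Units (skew_ring \<sigma>)"
    using assms(1) rs(2) by (auto simp: irreducible_elt_def)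
  moreover have "s \<notin> Units (skew_ring \<sigma>)"
  proof
    assume "s \<in> Units (skew_ring \<sigma>)"
    then obtain t where "t \<diamondop> s = 1" by (auto simp: Units_def)
    then have "e = t \<diamondop> f" using rs(2) by (metis skew_mult_1_left skew_mult_assoc)
    then have "b \<in> Rf" using rs(1) by (simp add: mult_Rf)
    then show False using assms(2) by simp
  qed
  ultimately obtain t where "t \<diamondop> e = 1" by (auto simp: Units_def)
  then have "(t \<diamondop> p) \<diamondop> b - 1 = - (t \<diamondop> (q \<diamondop> f))"
    using e(2) by (simp add: skew_distrib skew_mult_assoc algebra_simps)
  then show thesis using that[of "t \<diamondop> p"] by (simp add: mult_Rf)
qed

text \<open>Left multiplication by \<open>x\<close> on \<open>R/Rg\<close> and on \<open>R/Rf\<close> are \<open>\<sigma>\<close>-conjugate by the matrix of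
  \<open>r \<mapsto> r b\<close>, whose determinant is \<open>t\<close>. That matrix is invertible since \<open>b\<close> generates the simple module
  \<open>R/Rf\<close>.\<close>
lemma annihilator_constant_term:
  assumes irr: "irreducible_elt (skew_ring \<sigma>) f"
    and g: "g \<noteq> 0" "degree g \<le> d" "g \<diamondop> b \<in> Rf" and b: "b \<notin> Rf"
  obtains t where "degree g = d" "t \<noteq> 0" "coeff g 0 * t = lead_coeff g * coeff f 0 * \<sigma> t"
proof -
  define B where "B = mat d d (\<lambda>(i, j). coeff (md (monom 1 i \<diamondop> b)) j)"
  have B: "B \<in> carrier_mat d d" by (simp add: B_def)
  have B_row: "B $$ (i, k) = coeff (md (monom 1 i \<diamondop> b)) k" if "i < d" "k < d" for i k
    using that by (simp add: B_def)
  obtain p where p: "p \<diamondop> b - 1 \<in> Rf" using generates_quotient[OF irr b] .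
  \<comment> \<open>Since \<open>p \<diamondop> b\<close> is 1 in the quotient,
    \<open>y \<diamondop> p\<close> is a preimage of \<open>y\<close>. As \<open>g\<close> kills
    \<open>b\<close>, it may be replaced by its remainder modulo \<open>g\<close>.\<close>
  have "\<exists>r. (r = 0 \<or> degree r < degree g) \<and> md (r \<diamondop> b) = md y" for y
  proof -
    obtain q r where qr: "y \<diamondop> p = q \<diamondop> g + r" "r = 0 \<or> degree r < degree g"
      using skew_division[OF g(1)] by blast
    have "r \<diamondop> b - y = y \<diamondop> (p \<diamondop> b - 1) - q \<diamondop> (g \<diamondop> b)"
      using qr(1) by (simp add: skew_distrib skew_mult_assoc[symmetric] algebra_simps)
    also have "\<dots> \<in> Rf" by (intro diff_Rf mult_Rf p g)
    finally show ?thesis using qr(2) md_eq_iff by blast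
  qed
  then obtain R where R: "\<And>y. R y = 0 \<or> degree (R y) < degree g" "\<And>y. md (R y \<diamondop> b) = md y"
    by metis
  \<comment> \<open>The rows of \<open>D\<close> are coordinates of preimages of the powers of
    \<open>x\<close>, which makes \<open>D\<close> a left inverse of \<open>B\<close>.\<close>
  define D where "D = mat d d (\<lambda>(i, j). coeff (R (monom 1 i)) j)"
  have D: "D \<in> carrier_mat d d" by (simp add: D_def)
  have "D * B = 1\<^sub>m d"
  proof (rule eq_matI)
    fix i k assume "i < dim_row (1\<^sub>m d :: 'a mat)" "k < dim_col (1\<^sub>m d :: 'a mat)"
    then have ik: "i < d" "k < d" by simp_all
    have deg: "degree (R (monom 1 i)) < d"
      using R(1)[of "monom 1 i"] g(2) degree_f by auto
    have "(D * B) $$ (i, k) = (\<Sum>j<d. D $$ (i, j) * B $$ (j, k))"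
      using ik D B by (simp add: scalar_prod_def lessThan_atLeast0)
    also have "\<dots> = coeff (md (R (monom 1 i) \<diamondop> b)) k"
      unfolding coeff_md_mult_small[OF deg] using ik by (simp add: D_def B_row)
    also have "\<dots> = coeff (monom 1 i) k"
      unfolding R(2) using ik by (simp add: degree_monom_eq)
    finally show "(D * B) $$ (i, k) = 1\<^sub>m d $$ (i, k)" using ik by simp
  qed (use D B in auto)
  then have det_DB: "det D * det B = 1"
    using det_mult[OF D B] by simp
  \<comment> \<open>If the degree of \<open>g\<close> were smaller, all these preimages would have
    degree below \<open>d - 1\<close>, or vanish, and the last column of \<open>D\<close> would be
    zero.\<close>
  have deg_g: "degree g = d"
  proof (rule ccontr)
    assume "degree g \<noteq> d"
    then have "D $$ (i, d - 1) = 0" if "i < d" for i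
      using R(1)[of "monom 1 i"] g(2) that degree_f by (auto simp: D_def coeff_eq_0)
    then have "det D = 0"
      using laplace_expansion_column[OF D, of "d - 1"] degree_f by simp
    then show False using det_DB by simp
  qed
  define h where "h = smult (inverse (lead_coeff g)) g"
  have lead: "lead_coeff g \<noteq> 0" using g(1) by simp
  have h: "degree h = d" "coeff h d = 1" "h \<diamondop> b \<in> Rf"
    using lead deg_g g(3) by (simp_all add: h_def skew_mult_smult_left smult_Rf)
  let ?C = "companion h d" and ?C' = "companion f d"
  have C: "?C \<in> carrier_mat d d" "?C' \<in> carrier_mat d d" by (simp_all add: companion_def)
  interpret comm_ring_hom \<sigma> by (rule sigma_comm_ring_hom)
  \<comment> \<open>Row \<open>i\<close> of either side consists of the coordinates of the coset of
    \<open>monom 1 (Suc i) \<diamondop> b\<close>. On the left, the last row uses that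
    \<open>h\<close> kills \<open>b\<close>.\<close>
  have "?C * B = map_mat \<sigma> B * ?C'"
  proof (rule eq_matI)
    fix i k assume "i < dim_row (map_mat \<sigma> B * ?C')" "k < dim_col (map_mat \<sigma> B * ?C')"
    then have ik: "i < d" "k < d" using B C by simp_all
    have "(map_mat \<sigma> B * ?C') $$ (i, k) = (\<Sum>j<d. \<sigma> (B $$ (i, j)) * ?C' $$ (j, k))"
      using ik C B by (simp add: scalar_prod_def lessThan_atLeast0)
    also have "\<dots> = coeff (md (monom 1 1 \<diamondop> md (monom 1 i \<diamondop> b))) k"
      using ik by (subst companion_x) (auto simp: B_row)
    also have "\<dots> = coeff (md (monom 1 (Suc i) \<diamondop> b)) k"
      by (simp add: md_mult skew_mult_assoc[symmetric] monom_mult_monom)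
    finally have rhs: "(map_mat \<sigma> B * ?C') $$ (i, k) = coeff (md (monom 1 (Suc i) \<diamondop> b)) k" .
    have "(?C * B) $$ (i, k) = (\<Sum>j<d. ?C $$ (i, j) * B $$ (j, k))"
      using ik C B by (simp add: scalar_prod_def lessThan_atLeast0)
    also have "\<dots> = coeff (md (monom 1 (Suc i) \<diamondop> b)) k"
    proof (cases "i = d - 1")
      case True
      have "0 = coeff (md (h \<diamondop> b)) k" using h(3) md_eq_0_iff[of "h \<diamondop> b"] by simp
      also have "\<dots> = (\<Sum>j\<le>d. coeff h j * coeff (md (monom 1 j \<diamondop> b)) k)"
        by (rule coeff_md_mult) (simp add: h)
      also have "\<dots> = (\<Sum>j<d. coeff h j * B $$ (j, k)) + coeff (md (monom 1 d \<diamondop> b)) k"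
        using ik by (simp add: lessThan_Suc_atMost[symmetric] B_row h(2))
      finally have "- (\<Sum>j<d. coeff h j * B $$ (j, k)) = coeff (md (monom 1 d \<diamondop> b)) k"
        by (intro minus_unique) simp
      then show ?thesis
        using True ik by (simp add: companion_def sum_negf)
    next
      case False
      have "(\<Sum>j<d. ?C $$ (i, j) * B $$ (j, k)) = (\<Sum>j<d. if j = Suc i then B $$ (j, k) else 0)"
        using False ik by (intro sum.cong refl) (simp add: companion_def)
      then show ?thesis using False ik by (simp add: B_row)
    qed
    finally show "(?C * B) $$ (i, k) = (map_mat \<sigma> B * ?C') $$ (i, k)" using rhs by simp
  qed (use B C in auto)
  then have "det ?C * det B = \<sigma> (det B) * det ?C'"
    using det_mult[OF C(1) B] det_mult[of "map_mat \<sigma> B" d ?C'] B C hom_det[of B] by simp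
  \<comment> \<open>Both companion determinants carry the same sign, which cancels.\<close>
  then have "coeff h 0 * det B = \<sigma> (det B) * coeff f 0"
    using degree_f by (simp add: det_companion)
  then have "coeff g 0 * det B = lead_coeff g * coeff f 0 * \<sigma> (det B)"
    using lead by (simp add: h_def field_simps)
  moreover have "det B \<noteq> 0" using det_DB by auto
  ultimately show thesis using that deg_g by blast
qed

end

section \<open>The division algebra\<close>

text \<open>The hypotheses have the form in which they are used: \<open>norm\<close> excludes the
  equation that a zero divisor would produce, \<open>c\<close> is the bound, entering through its
  degree and its left multiples, and \<open>u\<close> is an inverse of \<open>x\<close> on the
  quotient module.\<close>

locale star_setting = skew_quotient \<sigma> f for \<sigma> :: "'a::field \<Rightarrow> 'a" and f :: "'a poly" +
  fixes \<rho> :: "'a \<Rightarrow> 'a" and \<eta> :: 'a and c u :: "'a poly" and K' :: "'a set"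
  assumes irreducible_f: "irreducible_elt (skew_ring \<sigma>) f"
    and degree_f_gt_2: "degree f > 2"
    and rho: "skew_poly \<rho>"
    and eta_nonzero: "\<eta> \<noteq> 0"
    and K'_eq: "K' = fixed_by \<rho> \<inter> fixed_by \<sigma>"
    and subfield_K': "subfield K' fld"
    and finite_K': "ring.finite_dimension fld K' UNIV"
    and norm: "\<And>a t. a \<noteq> 0 \<Longrightarrow> t \<noteq> 0 \<Longrightarrow> a * t \<noteq> \<eta> * \<rho> a * coeff f 0 * \<sigma> t"
    and degree_c: "degree c > degree f + 1"
    and annihilator_subset: "\<And>p. (\<And>r. p \<diamondop> r \<in> Rf) \<Longrightarrow> \<exists>q. p = q \<diamondop> c"
    and X_u_annihilator: "\<And>r. (monom 1 1 \<diamondop> u - 1) \<diamondop> r \<in> Rf"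
    and u_X_eq: "u \<diamondop> monom 1 1 = monom 1 1 \<diamondop> u"
begin

abbreviation \<xi> :: "'a poly" where "\<xi> \<equiv> monom 1 1"

lemmas rho_simps [simp] = skew_poly.sigma_add[OF rho] skew_poly.sigma_mult[OF rho]
  skew_poly.sigma_0[OF rho] skew_poly.sigma_1[OF rho] skew_poly.sigma_eq_0_iff[OF rho]
  skew_poly.sigma_eq_iff[OF rho] skew_poly.sigma_minus[OF rho]

lemma K'_fixed: "k \<in> K' \<Longrightarrow> \<rho> k = k" "k \<in> K' \<Longrightarrow> \<sigma> k = k"
  by (auto simp: K'_eq fixed_by_def)

section \<open>The annihilator of the module \<open>R/Rf\<close>\<close>

definition Ann :: "'a poly set" where "Ann = {p. \<forall>r. p \<diamondop> r \<in> Rf}"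

lemma Ann_Rf: "p \<in> Ann \<Longrightarrow> p \<in> Rf"
  unfolding Ann_def using skew_mult_1_right by (metis mem_Collect_eq)

lemma Ann_add: "p \<in> Ann \<Longrightarrow> q \<in> Ann \<Longrightarrow> p + q \<in> Ann"
  by (simp add: Ann_def skew_distrib add_Rf)

lemma Ann_uminus: "p \<in> Ann \<Longrightarrow> - p \<in> Ann"
  by (simp add: Ann_def skew_mult_minus_left)

lemma Ann_mult_left: "p \<in> Ann \<Longrightarrow> q \<diamondop> p \<in> Ann"
  by (simp add: Ann_def skew_mult_assoc mult_Rf)

lemma Ann_mult_right: "p \<in> Ann \<Longrightarrow> p \<diamondop> q \<in> Ann"
  by (simp add: Ann_def skew_mult_assoc)

lemma Ann_sym: "p - q \<in> Ann \<Longrightarrow> q - p \<in> Ann"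
  using Ann_uminus[of "p - q"] by simp

lemma Ann_trans: "p - q \<in> Ann \<Longrightarrow> q - r \<in> Ann \<Longrightarrow> p - r \<in> Ann"
  using Ann_add[of "p - q" "q - r"] by simp

text \<open>A nonzero left multiple of \<open>c\<close> has degree at least that of
  \<open>c\<close>, which exceeds \<open>d + 1\<close>.\<close>

lemma Ann_small:
  assumes "p \<in> Ann" "degree p \<le> d + 1"
  shows "p = 0"
proof -
  obtain q where "p = q \<diamondop> c" using assms(1) annihilator_subset by (auto simp: Ann_def)
  then show ?thesis
    using assms(2) degree_c degree_skew_mult[of q c] by (cases "q = 0 \<or> c = 0") auto
qed

lemma Ann_diff_small:
  assumes "p - q \<in> Ann" "degree p \<le> d + 1" "degree q \<le> d + 1"
  shows "p = q"
  using Ann_small[OF assms(1) degree_diff_le[OF assms(2,3)]] by simp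

lemma X_u_Ann: "\<xi> \<diamondop> u - 1 \<in> Ann" and u_X_Ann: "u \<diamondop> \<xi> - 1 \<in> Ann"
  using X_u_annihilator unfolding Ann_def u_X_eq by blast+

lemma cancel_X_u: "p \<diamondop> (\<xi> \<diamondop> (u \<diamondop> q)) - p \<diamondop> q \<in> Ann"
  using Ann_mult_left[OF Ann_mult_right[OF X_u_Ann], of p q]
  by (simp add: skew_distrib skew_mult_assoc)

lemma cancel_u_X: "p \<diamondop> (u \<diamondop> (\<xi> \<diamondop> q)) - p \<diamondop> q \<in> Ann"
  using Ann_mult_left[OF Ann_mult_right[OF u_X_Ann], of p q]
  by (simp add: skew_distrib skew_mult_assoc)

lemma md_cong_Ann: "p - q \<in> Ann \<Longrightarrow> md p = md q"
  using Ann_Rf md_eq_iff by blast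

lemma degree_X [simp]: "degree (\<xi> :: 'a poly) = Suc 0"
  by (simp add: degree_monom_eq)

lemma degree_small_simps [simp]: "Suc 0 < d" "Suc (Suc 0) < d" "0 < d"
  using degree_f_gt_2 by auto

lemma degree_monom_small [simp]: "i < d \<Longrightarrow> degree (monom a i) < d"
  by (rule le_less_trans[OF degree_monom_le])

section \<open>The representatives that act in the product\<close>

definition twist :: "'a \<Rightarrow> 'a" where "twist a = a - \<eta> * \<rho> a * coeff f 0"

lemma twist_add: "twist (a + b) = twist a + twist b"
  by (simp add: twist_def algebra_simps)

lemma twist_smult: "k \<in> K' \<Longrightarrow> twist (k * a) = k * twist a"
  using K'_fixed(1) by (simp add: twist_def algebra_simps)

text \<open>A kernel element would violate \<open>norm\<close> with \<open>t = 1\<close>;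
  surjectivity follows because the map is linear over \<open>K'\<close> and the field is finite over
  \<open>K'\<close>. This gives meaning to the definite description in \<open>star\<close>.\<close>

lemma bij_twist: "bij twist"
proof -
  have ker: "a = 0" if "twist a = 0" for a
    using that norm[of a 1] by (auto simp: twist_def)
  have "inj twist"
  proof (rule injI)
    fix a b assume "twist a = twist b"
    moreover have "twist (a - b) + twist b = twist a" using twist_add[of "a - b" b] by simp
    ultimately show "a = b" using ker[of "a - b"] by simp
  qed
  moreover have "surj twist"
    by (rule inj_linear_surj_field[OF subfield_K' finite_K' twist_add twist_smult ker])
  ultimately show ?thesis by (simp add: bij_def)
qed

text \<open>\<open>lift a\<close> is the representative \<open>a + \<eta> \<rho>(a\<^sub>0) f\<close> of the coset \<open>a + Rf\<close> that acts in the product \<open>\<star>\<close>;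
  the lifts are the polynomials \<open>g\<close> of degree at most \<open>d\<close> with \<open>g\<^sub>d = \<eta> \<rho>(g\<^sub>0)\<close>.\<close>
definition lift :: "'a poly \<Rightarrow> 'a poly" where
  "lift a = a + smult (\<eta> * \<rho> (THE a0. a0 - \<eta> * \<rho> a0 * coeff f 0 = coeff a 0)) f"

definition S :: "'a poly set" where
  "S = {g. degree g \<le> d \<and> coeff g d = \<eta> * \<rho> (coeff g 0)}"

lemma lift_eq:
  assumes "twist a0 = coeff a 0"
  shows "lift a = a + smult (\<eta> * \<rho> a0) f"
proof -
  have "(THE a0. a0 - \<eta> * \<rho> a0 * coeff f 0 = coeff a 0) = a0"
    using assms bij_twist unfolding twist_def[symmetric]
    by (intro the_equality) (metis bij_is_inj injD)+
  then show ?thesis by (simp add: lift_def)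
qed

lemma lift_obtain:
  obtains a0 where "twist a0 = coeff a 0" "lift a = a + smult (\<eta> * \<rho> a0) f"
proof -
  obtain a0 where "twist a0 = coeff a 0" using bij_twist by (metis bij_pointE)
  then show thesis using that lift_eq by blast
qed

lemma lift_S:
  assumes "degree a < d"
  shows "lift a \<in> S"
proof -
  obtain a0 where a0: "twist a0 = coeff a 0" "lift a = a + smult (\<eta> * \<rho> a0) f"
    by (rule lift_obtain)
  have "degree (lift a) \<le> d"
    unfolding a0(2) by (intro degree_add_le le_trans[OF degree_smult_le]) (use assms in auto)
  \<comment> \<open>The added multiple of \<open>f\<close> restores exactly what
    \<open>twist\<close> subtracts, so the constant coefficient is the parameter itself.\<close>
  moreover have "coeff (lift a) 0 = a0"
    by (simp add: a0(2) a0(1)[symmetric]) (simp add: twist_def)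
  moreover have "coeff (lift a) d = \<eta> * \<rho> a0"
    using assms monic_f by (simp add: a0(2) coeff_eq_0)
  ultimately show ?thesis by (simp add: S_def)
qed

lemma lift_surj:
  assumes "g \<in> S"
  obtains a where "degree a < d" "lift a = g"
proof -
  \<comment> \<open>As \<open>f\<close> is monic, this removes the term of degree \<open>d\<close>;
    membership in \<open>S\<close> makes the removed multiple the one that \<open>lift\<close> adds
    back.\<close>
  define a where "a = g - smult (coeff g d) f"
  have "degree a \<le> d"
    unfolding a_def by (intro degree_diff_le le_trans[OF degree_smult_le]) (use assms in \<open>auto simp: S_def\<close>)
  moreover have "coeff a d = 0" using monic_f by (simp add: a_def)
  ultimately have "degree a < d"
    using degree_f by (metis leading_coeff_0_iff degree_0 le_neq_implies_less)
  moreover have "twist (coeff g 0) = coeff a 0"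
    using assms by (simp add: a_def twist_def S_def)
  then have "lift a = g" using lift_eq assms by (simp add: a_def S_def)
  ultimately show thesis using that by blast
qed

lemma lift_diff_Rf: "lift a - a \<in> Rf"
  by (rule lift_obtain[of a]) (simp add: smult_Rf)

lemma md_lift: "degree a < d \<Longrightarrow> md (lift a) = a"
  using lift_diff_Rf by (intro md_eqI)

lemma lift_add: "lift (a + b) = lift a + lift b"
proof -
  obtain a0 where a0: "twist a0 = coeff a 0" "lift a = a + smult (\<eta> * \<rho> a0) f"
    by (rule lift_obtain)
  obtain b0 where b0: "twist b0 = coeff b 0" "lift b = b + smult (\<eta> * \<rho> b0) f"
    by (rule lift_obtain)
  have "twist (a0 + b0) = coeff (a + b) 0"
    by (simp add: a0(1) b0(1) twist_add)
  then show ?thesis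
    using lift_eq[of "a0 + b0" "a + b"] a0(2) b0(2) by (simp add: smult_add_left algebra_simps)
qed

lemma lift_smult:
  assumes "k \<in> K'"
  shows "lift (smult k a) = smult k (lift a)"
proof -
  obtain a0 where a0: "twist a0 = coeff a 0" "lift a = a + smult (\<eta> * \<rho> a0) f"
    by (rule lift_obtain)
  have "twist (k * a0) = coeff (smult k a) 0"
    by (simp add: a0(1) twist_smult assms)
  then show ?thesis
    using lift_eq[of "k * a0" "smult k a"] a0(2) K'_fixed(1)[OF assms]
    by (simp add: smult_add_right mult_ac)
qed

lemma lift_eq_self: "coeff a 0 = 0 \<Longrightarrow> lift a = a"
  using lift_eq[of 0 a] by (simp add: twist_def)

text \<open>For \<open>g\<close> in \<open>S\<close>, the relation of
  \<open>annihilator_constant_term\<close> has leading coefficient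
  \<open>\<eta> * \<rho> (coeff g 0)\<close> and so is the equation excluded by
  \<open>norm\<close>.\<close>

lemma S_acts_injectively:
  assumes "g \<in> S" "g \<noteq> 0" "b \<notin> Rf"
  shows "g \<diamondop> b \<notin> Rf"
proof
  assume gb: "g \<diamondop> b \<in> Rf"
  have g: "degree g \<le> d" "coeff g d = \<eta> * \<rho> (coeff g 0)" using assms(1) by (auto simp: S_def)
  obtain t where t: "degree g = d" "t \<noteq> 0" "coeff g 0 * t = lead_coeff g * coeff f 0 * \<sigma> t"
    by (rule annihilator_constant_term[OF irreducible_f assms(2) g(1) gb assms(3)])
  have "coeff g 0 \<noteq> 0"
  proof
    assume "coeff g 0 = 0"
    then have "lead_coeff g = 0" using t(1) g(2) by simp
    then show False using assms(2) by simp
  qed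
  then show False using norm[of "coeff g 0" t] t g(2) by simp
qed

section \<open>The product and its division property\<close>

abbreviation star_mult :: "'a poly \<Rightarrow> 'a poly \<Rightarrow> 'a poly" (infixl \<open>\<star>\<close> 70) where
  "a \<star> b \<equiv> star \<sigma> \<rho> \<eta> f u a b"

abbreviation "A \<equiv> star_algebra \<sigma> \<rho> \<eta> f u"

lemma star_eq: "a \<star> b = md (lift a \<diamondop> (u \<diamondop> b))"
  by (simp add: star_def lift_def Let_def skew_mult_assoc)

lemma A_simps [simp]:
  "carrier A = {g. degree g < d}" "monoid.mult A = star \<sigma> \<rho> \<eta> f u" "\<one>\<^bsub>A\<^esub> = \<xi>" "\<zero>\<^bsub>A\<^esub> = 0"
  "a \<oplus>\<^bsub>A\<^esub> b = a + b" "k \<odot>\<^bsub>A\<^esub> a = smult k a"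
  by (simp_all add: star_algebra_def)

lemma degree_star [simp]: "degree (a \<star> b) < d"
  by (simp add: star_eq)

lemma star_add_left: "(a + b) \<star> e = a \<star> e + b \<star> e"
  by (simp add: star_eq lift_add skew_distrib md_add)

lemma star_add_right: "e \<star> (a + b) = e \<star> a + e \<star> b"
  by (simp add: star_eq skew_distrib md_add)

lemma star_smult_left: "k \<in> K' \<Longrightarrow> smult k a \<star> b = smult k (a \<star> b)"
  by (simp add: star_eq lift_smult skew_mult_smult_left md_smult)

lemma star_smult_right: "\<sigma> k = k \<Longrightarrow> a \<star> smult k b = smult k (a \<star> b)"
  by (simp add: star_eq skew_mult_smult_right md_smult)

text \<open>Without a constant term the lift is trivial, and one factor \<open>x\<close> cancels
  \<open>u\<close>. The index shift reflects that the identity of the algebra is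
  \<open>x\<close>.\<close>

lemma monom_star:
  assumes "degree b < d"
  shows "monom a (Suc i) \<star> b = md (monom a i \<diamondop> b)"
proof -
  have "monom a (Suc i) = monom a i \<diamondop> \<xi>" by (simp add: monom_mult_monom)
  then have "monom a (Suc i) \<star> b = md (monom a i \<diamondop> (\<xi> \<diamondop> (u \<diamondop> b)))"
    unfolding star_eq by (subst lift_eq_self) (simp_all add: skew_mult_assoc coeff_skew_mult_0)
  also have "\<dots> = md (monom a i \<diamondop> b)" by (rule md_cong_Ann[OF cancel_X_u])
  finally show ?thesis .
qed

lemma monom_1_star: "degree b < d \<Longrightarrow> monom a 1 \<star> b = smult a b"
  using monom_star[of b a 0] by (simp add: monom_0_mult md_smult)

lemma X_star: "degree b < d \<Longrightarrow> \<xi> \<star> b = b"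
  using monom_1_star[of b 1] by simp

lemma star_X: "degree a < d \<Longrightarrow> a \<star> \<xi> = a"
  using md_cong_Ann[OF cancel_u_X[of "lift a" 1]] by (simp add: star_eq md_lift)

text \<open>The factor \<open>u\<close> acts injectively on the quotient because \<open>x\<close>
  undoes it, and the lift of \<open>a\<close> acts injectively as a nonzero element of
  \<open>S\<close>.\<close>

lemma star_nonzero:
  assumes "degree a < d" "degree b < d" "a \<noteq> 0" "b \<noteq> 0"
  shows "a \<star> b \<noteq> 0"
proof -
  have "u \<diamondop> b \<notin> Rf"
  proof
    assume "u \<diamondop> b \<in> Rf"
    then have "\<xi> \<diamondop> (u \<diamondop> b) \<in> Rf" by (rule mult_Rf)
    then have "b \<in> Rf" using Rf_diff_iff[OF Ann_Rf[OF cancel_X_u[of 1 b]]] by simp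
    then show False using Rf_small assms by blast
  qed
  moreover have "lift a \<noteq> 0" using md_lift[OF assms(1)] assms(3) by auto
  ultimately show ?thesis
    using S_acts_injectively[OF lift_S[OF assms(1)]] by (simp add: star_eq md_eq_0_iff)
qed

lemma inj_on_additive:
  fixes T :: "'a poly \<Rightarrow> 'a poly"
  assumes "\<And>p q. degree p < d \<Longrightarrow> degree q < d \<Longrightarrow> T (p + q) = T p + T q"
    and "\<And>p. degree p < d \<Longrightarrow> T p = 0 \<Longrightarrow> p = 0"
  shows "inj_on T {p. degree p < d}"
proof (rule inj_onI)
  fix p q assume pq: "p \<in> {p. degree p < d}" "q \<in> {p. degree p < d}" "T p = T q"
  have deg: "degree (p - q) < d" using pq degree_diff_less by blast
  have "T (p - q) + T q = T p" using assms(1)[OF deg, of q] pq by simp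
  then show "p = q" using assms(2)[OF deg] pq by simp
qed

text \<open>Translations are linear over \<open>K'\<close>, because \<open>\<rho>\<close> and
  \<open>\<sigma>\<close> fix \<open>K'\<close>, and injective by \<open>star_nonzero\<close>;
  finite dimension makes them bijective.\<close>

lemma star_algebra_division: "unital_division_algebra (fld\<lparr>carrier := K'\<rparr>) A"
proof -
  interpret fld: field "fld :: 'a ring" by (rule field_from_type_algebra)
  have field: "field ((fld :: 'a ring)\<lparr>carrier := K'\<rparr>)"
    by (rule fld.subfield_iff(2)[OF subfield_K'])
  have group: "abelian_group A"
  proof (rule abelian_groupI)
    show "\<exists>y\<in>carrier A. y \<oplus>\<^bsub>A\<^esub> x = \<zero>\<^bsub>A\<^esub>" if "x \<in> carrier A" for x
      using that by (intro bexI[of _ "- x"]) auto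
  qed (auto simp: add_ac degree_add_less)
  have deg_smult: "degree p < d \<Longrightarrow> degree (smult k p) < d" for k p
    by (rule le_less_trans[OF degree_smult_le])
  have mod: "Module.module ((fld :: 'a ring)\<lparr>carrier := K'\<rparr>) A"
    using field.axioms(1)[OF field] group
    by (intro moduleI) (auto simp: domain_def smult_add_left smult_add_right deg_smult)
  have bij: "bij_betw (\<lambda>b. a \<star> b) {p. degree p < d} {p. degree p < d} \<and>
      bij_betw (\<lambda>b. b \<star> a) {p. degree p < d} {p. degree p < d}"
    if a: "degree a < d" "a \<noteq> 0" for a
  proof (intro conjI bij_betw_imageI)
    show "inj_on (\<lambda>b. a \<star> b) {p. degree p < d}"
      by (rule inj_on_additive) (use star_add_right star_nonzero a in blast)+
    show "inj_on (\<lambda>b. b \<star> a) {p. degree p < d}"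
      by (rule inj_on_additive) (use star_add_left star_nonzero a in blast)+
    show "(\<lambda>b. a \<star> b) ` {p. degree p < d} = {p. degree p < d}"
      by (rule inj_linear_surj_poly[OF subfield_K' finite_K' degree_f])
        (use star_add_right star_smult_right K'_fixed star_nonzero a in \<open>auto dest: star_nonzero\<close>)
    show "(\<lambda>b. b \<star> a) ` {p. degree p < d} = {p. degree p < d}"
      by (rule inj_linear_surj_poly[OF subfield_K' finite_K' degree_f])
        (use star_add_left star_smult_left star_nonzero a in \<open>auto dest: star_nonzero\<close>)
  qed
  show ?thesis
    unfolding unital_division_algebra_def
    using field mod bij
    by (simp add: star_add_left star_add_right star_smult_left star_smult_right K'_fixed X_star star_X
        del: One_nat_def)
qed

end

section \<open>Nuclei and center\<close>

context star_setting
begin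

lemma degree_f_nonzero [simp]: "d \<noteq> 0"
  using degree_f by linarith

text \<open>Associativity for all third factors compares two left multiplications on
  \<open>R/Rf\<close>, that is, two elements modulo \<open>Ann\<close>. The trailing
  \<open>u\<close> is invertible there, which leaves the lift of \<open>a \<star> b\<close> as the
  required element of \<open>S\<close>.\<close>

lemma associates_iff:
  assumes "degree a < d" "degree b < d"
  shows "(\<forall>e. degree e < d \<longrightarrow> a \<star> (b \<star> e) = (a \<star> b) \<star> e) \<longleftrightarrow>
    (\<exists>g\<in>S. lift a \<diamondop> (u \<diamondop> lift b) - g \<in> Ann)"
proof
  assume assoc: "\<forall>e. degree e < d \<longrightarrow> a \<star> (b \<star> e) = (a \<star> b) \<star> e"
  define h where "h = lift a \<diamondop> (u \<diamondop> (lift b \<diamondop> u)) - lift (a \<star> b) \<diamondop> u"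
  have small: "h \<diamondop> e \<in> Rf" if "degree e < d" for e
  proof -
    have "md (lift a \<diamondop> (u \<diamondop> (lift b \<diamondop> (u \<diamondop> e)))) = a \<star> (b \<star> e)"
      using md_mult[of "lift a \<diamondop> u"] by (simp add: star_eq skew_mult_assoc)
    also have "\<dots> = md (lift (a \<star> b) \<diamondop> (u \<diamondop> e))"
      using assoc that by (simp add: star_eq)
    finally show ?thesis by (simp add: md_eq_iff h_def skew_distrib skew_mult_assoc)
  qed
  have h_Rf: "h \<diamondop> r \<in> Rf" for r
    using small[of "md r"] mult_Rf[OF diff_md_Rf[of r], of h] Rf_diff_iff[of "h \<diamondop> r" "h \<diamondop> md r"]
    by (simp add: skew_distrib)
  \<comment> \<open>Right multiplication by \<open>x\<close> removes the trailing \<open>u\<close>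
    from both terms of \<open>h\<close>.\<close>
  have "h \<diamondop> \<xi> \<in> Ann" by (rule Ann_mult_right) (simp add: Ann_def h_Rf)
  then have "lift a \<diamondop> (u \<diamondop> (lift b \<diamondop> (u \<diamondop> \<xi>))) - lift (a \<star> b) \<diamondop> (u \<diamondop> \<xi>) \<in> Ann"
    by (simp add: h_def skew_distrib skew_mult_assoc)
  moreover have "lift a \<diamondop> (u \<diamondop> lift b) - lift a \<diamondop> (u \<diamondop> (lift b \<diamondop> (u \<diamondop> \<xi>))) \<in> Ann"
    using Ann_sym[OF cancel_u_X[of "lift a \<diamondop> (u \<diamondop> lift b)" 1]] by (simp add: skew_mult_assoc)
  moreover have "lift (a \<star> b) \<diamondop> (u \<diamondop> \<xi>) - lift (a \<star> b) \<in> Ann"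
    using cancel_u_X[of "lift (a \<star> b)" 1] by simp
  ultimately have "lift a \<diamondop> (u \<diamondop> lift b) - lift (a \<star> b) \<in> Ann"
    by (blast intro: Ann_trans)
  then show "\<exists>g\<in>S. lift a \<diamondop> (u \<diamondop> lift b) - g \<in> Ann"
    using lift_S[OF degree_star] by blast
next
  assume "\<exists>g\<in>S. lift a \<diamondop> (u \<diamondop> lift b) - g \<in> Ann"
  then obtain e where e: "degree e < d" "lift a \<diamondop> (u \<diamondop> lift b) - lift e \<in> Ann"
    by (metis lift_surj)
  \<comment> \<open>An element of \<open>S\<close> congruent to the product must be the lift of
    \<open>a \<star> b\<close>, as reduction modulo \<open>f\<close> recovers
    \<open>e\<close>.\<close>
  have "a \<star> b = md (lift a \<diamondop> (u \<diamondop> lift b))"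
    using md_mult[of "lift a \<diamondop> u" "lift b"] assms(2) by (simp add: star_eq skew_mult_assoc md_lift)
  also have "\<dots> = e" using md_cong_Ann[OF e(2)] e(1) by (simp add: md_lift)
  finally have ab: "a \<star> b = e" .
  have "a \<star> (b \<star> y) = (a \<star> b) \<star> y" for y
  proof -
    have "a \<star> (b \<star> y) = md ((lift a \<diamondop> (u \<diamondop> lift b)) \<diamondop> (u \<diamondop> y))"
      using md_mult[of "lift a \<diamondop> u"] by (simp add: star_eq skew_mult_assoc)
    also have "\<dots> = md (lift e \<diamondop> (u \<diamondop> y))"
      by (rule md_cong_Ann) (use Ann_mult_right[OF e(2)] in \<open>simp add: skew_distrib\<close>)
    finally show ?thesis by (simp only: ab star_eq[of e y])
  qed
  then show "\<forall>e. degree e < d \<longrightarrow> a \<star> (b \<star> e) = (a \<star> b) \<star> e" by blast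
qed

text \<open>As \<open>b\<close> ranges over the algebra its lift ranges over \<open>S\<close>, so
  the nucleus condition becomes stability of \<open>S\<close> modulo \<open>Ann\<close>.\<close>

lemma left_nucleus_iff:
  "a \<in> left_nucleus A \<longleftrightarrow> degree a < d \<and> (\<forall>g\<in>S. \<exists>g'\<in>S. lift a \<diamondop> (u \<diamondop> g) - g' \<in> Ann)"
proof -
  have "a \<in> left_nucleus A \<longleftrightarrow> degree a < d \<and> (\<forall>b. degree b < d \<longrightarrow>
      (\<forall>e. degree e < d \<longrightarrow> a \<star> (b \<star> e) = (a \<star> b) \<star> e))"
    by (auto simp: left_nucleus_def)
  also have "\<dots> \<longleftrightarrow> degree a < d \<and> (\<forall>g\<in>S. \<exists>g'\<in>S. lift a \<diamondop> (u \<diamondop> g) - g' \<in> Ann)"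
    using associates_iff lift_S lift_surj by (metis (no_types, lifting))
  finally show ?thesis .
qed

lemma middle_nucleus_iff:
  "b \<in> middle_nucleus A \<longleftrightarrow> degree b < d \<and> (\<forall>g\<in>S. \<exists>g'\<in>S. g \<diamondop> (u \<diamondop> lift b) - g' \<in> Ann)"
proof -
  have "b \<in> middle_nucleus A \<longleftrightarrow> degree b < d \<and> (\<forall>a. degree a < d \<longrightarrow>
      (\<forall>e. degree e < d \<longrightarrow> a \<star> (b \<star> e) = (a \<star> b) \<star> e))"
    by (auto simp: middle_nucleus_def)
  also have "\<dots> \<longleftrightarrow> degree b < d \<and> (\<forall>g\<in>S. \<exists>g'\<in>S. g \<diamondop> (u \<diamondop> lift b) - g' \<in> Ann)"
    using associates_iff lift_S lift_surj by (metis (no_types, lifting))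
  finally show ?thesis .
qed

text \<open>If \<open>p\<close> and its shifts by \<open>x\<close>, up to \<open>x\<^sup>d\<^sup>-\<^sup>2\<close>, lie in \<open>S\<close> modulo \<open>Ann\<close>, then they lie in \<open>S\<close>, as \<open>Ann\<close>
  contains no nonzero element of small degree; a shift has no constant term and hence degree less
  than \<open>d\<close>.\<close>
lemma shifts_in_S_imp_monom:
  assumes "p \<in> S"
    and shift: "\<And>j. 1 \<le> j \<Longrightarrow> j \<le> d - 2 \<Longrightarrow> \<exists>g\<in>S. q j - g \<in> Ann"
    and degree_q: "\<And>j. p \<noteq> 0 \<Longrightarrow> degree (q j) = degree p + j"
    and coeff_q: "\<And>j. 1 \<le> j \<Longrightarrow> coeff (q j) 0 = 0"
  obtains \<alpha> where "p = monom \<alpha> 1"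
proof (cases "p = 0")
  case True
  then show thesis using that[of 0] by simp
next
  case False
  have bound: "degree p + j \<le> d - 1" if "1 \<le> j" "j \<le> d - 2" for j
    using that
  proof (induction j)
    case (Suc j)
    \<comment> \<open>The first shift has degree at most \<open>d + 1\<close>, just within the range
      of \<open>Ann_diff_small\<close>; later shifts are controlled by the induction
      hypothesis.\<close>
    have le: "degree p + Suc j \<le> d + 1"
      using Suc assms(1) by (cases "j = 0") (auto simp: S_def)
    obtain g where g: "g \<in> S" "q (Suc j) - g \<in> Ann"
      using shift Suc.prems by blast
    then have "q (Suc j) = g"
      using Ann_diff_small[of "q (Suc j)" g] le degree_q[OF False] by (auto simp: S_def)
    then have q: "degree (q (Suc j)) \<le> d" "coeff (q (Suc j)) d = 0"
      using g(1) coeff_q[of "Suc j"] by (auto simp: S_def)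
    have "degree (q (Suc j)) \<noteq> d"
      using q(2) degree_f by (metis leading_coeff_0_iff degree_0 less_irrefl)
    then show ?case using q(1) degree_q[OF False] by simp
  qed simp
  \<comment> \<open>The last shift \<open>d - 2\<close> leaves degree at most 1. The vanishing
    coefficient in degree \<open>d\<close> then forces the constant term of an element of
    \<open>S\<close> to vanish.\<close>
  then have deg: "degree p \<le> 1"
    using bound[of "d - 2"] degree_f_gt_2 by linarith
  then have "coeff p d = 0" using degree_f_gt_2 by (simp add: coeff_eq_0)
  then have "coeff p 0 = 0" using assms(1) eta_nonzero by (auto simp: S_def)
  then have "p = monom (coeff p 1) 1"
  proof (intro poly_eqI)
    fix n :: nat
    consider "n = 0" | "n = 1" | "n > 1" by linarith
    then show "coeff p n = coeff (monom (coeff p 1) 1) n"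
      using deg \<open>coeff p 0 = 0\<close> by cases (auto simp: coeff_eq_0)
  qed
  then show thesis using that by blast
qed

lemma monom_S: "1 \<le> i \<Longrightarrow> i < d \<Longrightarrow> monom a i \<in> S"
  by (auto simp: S_def intro: less_imp_le)

text \<open>This test element has both ends nonzero, so multiplying it by a constant compares the
  constant with its image under \<open>\<rho>\<close>.\<close>

lemma one_plus_S: "1 + monom \<eta> d \<in> S"
proof -
  have "degree (1 + monom \<eta> d) \<le> d" by (intro degree_add_le degree_monom_le) simp
  then show ?thesis by (simp add: S_def)
qed

lemma lift_monom_1: "lift (monom a 1) = monom a 1"
  by (rule lift_eq_self) simp

text \<open>Powers of \<open>x\<close> in \<open>S\<close> reduce the lift to
  \<open>monom \<alpha> 1\<close>, which acts on \<open>S\<close> as scaling by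
  \<open>\<alpha>\<close> once \<open>x\<close> has cancelled \<open>u\<close>. Scaling preserves
  the defining relation of \<open>S\<close> exactly when \<open>\<rho>\<close> fixes
  \<open>\<alpha>\<close>.\<close>

lemma left_nucleus_eq: "left_nucleus A = (\<lambda>\<alpha>. monom \<alpha> 1) ` fixed_by \<rho>"
proof (intro equalityI subsetI)
  fix a assume "a \<in> left_nucleus A"
  then have a: "degree a < d" and idealiser: "\<And>g. g \<in> S \<Longrightarrow> \<exists>g'\<in>S. lift a \<diamondop> (u \<diamondop> g) - g' \<in> Ann"
    by (auto simp: left_nucleus_iff)
  obtain \<alpha> where \<alpha>: "lift a = monom \<alpha> 1"
  proof (rule shifts_in_S_imp_monom[OF lift_S[OF a], of "\<lambda>j. lift a \<diamondop> monom 1 j"])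
    fix j :: nat assume j: "1 \<le> j" "j \<le> d - 2"
    \<comment> \<open>The range of \<open>j\<close> keeps \<open>Suc j\<close> below
      \<open>d\<close>, so the monomial lies in \<open>S\<close>; its extra factor \<open>x\<close>
      absorbs \<open>u\<close>.\<close>
    obtain g' where g': "g' \<in> S" "lift a \<diamondop> (u \<diamondop> monom 1 (Suc j)) - g' \<in> Ann"
      using idealiser[OF monom_S[of "Suc j" 1]] j by force
    have "monom 1 (Suc j) = \<xi> \<diamondop> monom 1 j" by (simp add: monom_mult_monom)
    then have "lift a \<diamondop> monom 1 j - g' \<in> Ann"
      using Ann_trans[OF Ann_sym[OF cancel_u_X]] g'(2) by simp
    then show "\<exists>g\<in>S. lift a \<diamondop> monom 1 j - g \<in> Ann" using g'(1) by blast
  qed (auto simp: degree_skew_mult degree_monom_eq coeff_mult_monom)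
  have eq: "a = monom \<alpha> 1" using md_lift[OF a] \<alpha> by simp
  define g where "g = 1 + monom \<eta> d"
  have g: "g \<in> S" "degree g \<le> d" using one_plus_S by (auto simp: g_def S_def)
  obtain g' where g': "g' \<in> S" "monom \<alpha> 1 \<diamondop> (u \<diamondop> g) - g' \<in> Ann"
    using idealiser[OF g(1)] \<alpha> by auto
  have "monom \<alpha> 1 \<diamondop> (u \<diamondop> g) = monom \<alpha> 0 \<diamondop> (\<xi> \<diamondop> (u \<diamondop> g))"
    by (simp add: skew_mult_assoc[symmetric] monom_mult_monom)
  then have "monom \<alpha> 0 \<diamondop> g - g' \<in> Ann"
    using Ann_trans[OF Ann_sym[OF cancel_X_u]] g'(2) by simp
  then have "smult \<alpha> g - g' \<in> Ann" by (simp only: monom_0_mult)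
  moreover have "degree (smult \<alpha> g) \<le> d + 1"
    by (rule le_trans[OF degree_smult_le]) (use g(2) in simp)
  ultimately have "smult \<alpha> g = g'"
    using g'(1) by (intro Ann_diff_small) (auto simp: S_def)
  then have "\<alpha> * \<eta> = \<eta> * \<rho> \<alpha>" using g'(1) by (auto simp: S_def g_def)
  then have "\<alpha> \<in> fixed_by \<rho>" using eta_nonzero by (simp add: fixed_by_def)
  then show "a \<in> (\<lambda>\<alpha>. monom \<alpha> 1) ` fixed_by \<rho>" using eq by blast
next
  fix a assume "a \<in> (\<lambda>\<alpha>. monom \<alpha> 1) ` fixed_by \<rho>"
  then obtain \<alpha> where \<alpha>: "a = monom \<alpha> 1" "\<rho> \<alpha> = \<alpha>" by (auto simp: fixed_by_def)
  have "\<exists>g'\<in>S. lift a \<diamondop> (u \<diamondop> g) - g' \<in> Ann" if "g \<in> S" for g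
  proof
    show "smult \<alpha> g \<in> S"
      using that \<alpha>(2) by (auto simp: S_def intro: le_trans[OF degree_smult_le])
    have "lift a = monom \<alpha> 0 \<diamondop> \<xi>" by (simp add: \<alpha>(1) lift_monom_1[simplified] monom_mult_monom)
    then show "lift a \<diamondop> (u \<diamondop> g) - smult \<alpha> g \<in> Ann"
      using cancel_X_u[of "monom \<alpha> 0" g] by (simp only: monom_0_mult skew_mult_smult_left)
  qed
  then show "a \<in> left_nucleus A" unfolding left_nucleus_iff by (simp add: \<alpha>(1))
qed

text \<open>The parametrisation by \<open>\<sigma> \<beta>\<close> comes from \<open>\<xi>
  \<diamondop> monom \<beta> 0 = monom (\<sigma> \<beta>) 1\<close>. Right multiplication by
  \<open>\<beta>\<close> scales the constant coefficient by \<open>\<beta>\<close> and the one in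
  degree \<open>d\<close> by \<open>(\<sigma> ^^ d) \<beta>\<close>, so \<open>S\<close> is stable
  exactly when that value equals \<open>\<rho> \<beta>\<close>.\<close>

lemma middle_nucleus_eq:
  "middle_nucleus A = (\<lambda>\<beta>. monom (\<sigma> \<beta>) 1) ` fixed_by (inv_into UNIV \<rho> \<circ> \<sigma> ^^ d)"
proof -
  have bij_rho: "bij \<rho>" using skew_poly.sigma_bij[OF rho] .
  have fixed: "fixed_by (inv_into UNIV \<rho> \<circ> \<sigma> ^^ d) = {\<beta>. \<rho> \<beta> = (\<sigma> ^^ d) \<beta>}"
    using bij_rho by (auto simp: fixed_by_def bij_is_inj bij_is_surj surj_f_inv_f
        inv_f_eq) (metis bij_rho bij_is_surj surj_f_inv_f)
  have degree_mult: "degree (g \<diamondop> monom \<beta> 0) \<le> d" if "g \<in> S" for g \<beta>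
    using le_trans[OF degree_skew_mult_le, of g "monom \<beta> 0" d] that by (simp add: S_def monom_0)
  show ?thesis unfolding fixed
  proof (intro equalityI subsetI)
    fix b assume "b \<in> middle_nucleus A"
    then have b: "degree b < d" and idealiser: "\<And>g. g \<in> S \<Longrightarrow> \<exists>g'\<in>S. g \<diamondop> (u \<diamondop> lift b) - g' \<in> Ann"
      by (auto simp: middle_nucleus_iff)
    obtain \<alpha> where \<alpha>: "lift b = monom \<alpha> 1"
    proof (rule shifts_in_S_imp_monom[OF lift_S[OF b], of "\<lambda>j. monom 1 j \<diamondop> lift b"])
      fix j :: nat assume j: "1 \<le> j" "j \<le> d - 2"
      obtain g' where g': "g' \<in> S" "monom 1 (Suc j) \<diamondop> (u \<diamondop> lift b) - g' \<in> Ann"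
        using idealiser[OF monom_S[of "Suc j" 1]] j by force
      have "monom 1 (Suc j) = monom 1 j \<diamondop> \<xi>" by (simp add: monom_mult_monom)
      then have "monom 1 j \<diamondop> lift b - g' \<in> Ann"
        using Ann_trans[OF Ann_sym[OF cancel_X_u]] g'(2) by (simp add: skew_mult_assoc)
      then show "\<exists>g\<in>S. monom 1 j \<diamondop> lift b - g \<in> Ann" using g'(1) by blast
    qed (auto simp: degree_skew_mult degree_monom_eq coeff_monom_mult)
    have eq: "b = monom \<alpha> 1" using md_lift[OF b] \<alpha> by simp
    obtain \<beta> where \<beta>: "\<alpha> = \<sigma> \<beta>" using sigma_bij by (metis bij_pointE)
    define g where "g = 1 + monom \<eta> d"
    have g: "g \<in> S" using one_plus_S by (simp add: g_def)
    obtain g' where g': "g' \<in> S" "g \<diamondop> (u \<diamondop> monom \<alpha> 1) - g' \<in> Ann"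
      using idealiser[OF g] \<alpha> by auto
    have "monom \<alpha> 1 = \<xi> \<diamondop> monom \<beta> 0" by (simp add: \<beta> monom_mult_monom)
    then have "g \<diamondop> monom \<beta> 0 - g' \<in> Ann"
      using Ann_trans[OF Ann_sym[OF cancel_u_X]] g'(2) by simp
    then have "g \<diamondop> monom \<beta> 0 = g'"
      using g'(1) degree_mult[OF g] by (intro Ann_diff_small) (auto simp: S_def intro: le_SucI)
    then have "\<eta> * (\<sigma> ^^ d) \<beta> = \<eta> * \<rho> \<beta>"
      using g'(1) by (auto simp: S_def g_def coeff_mult_monom)
    then have "\<rho> \<beta> = (\<sigma> ^^ d) \<beta>" using eta_nonzero by simp
    then show "b \<in> (\<lambda>\<beta>. monom (\<sigma> \<beta>) 1) ` {\<beta>. \<rho> \<beta> = (\<sigma> ^^ d) \<beta>}" using eq \<beta> by blast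
  next
    fix b assume "b \<in> (\<lambda>\<beta>. monom (\<sigma> \<beta>) 1) ` {\<beta>. \<rho> \<beta> = (\<sigma> ^^ d) \<beta>}"
    then obtain \<beta> where \<beta>: "b = monom (\<sigma> \<beta>) 1" "\<rho> \<beta> = (\<sigma> ^^ d) \<beta>" by auto
    have "\<exists>g'\<in>S. g \<diamondop> (u \<diamondop> lift b) - g' \<in> Ann" if "g \<in> S" for g
    proof
      show "g \<diamondop> monom \<beta> 0 \<in> S"
        using that degree_mult[OF that] \<beta>(2) by (simp add: S_def coeff_mult_monom)
      have "lift b = \<xi> \<diamondop> monom \<beta> 0" by (simp add: \<beta>(1) lift_monom_1[simplified] monom_mult_monom)
      then show "g \<diamondop> (u \<diamondop> lift b) - g \<diamondop> monom \<beta> 0 \<in> Ann"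
        using cancel_u_X by simp
    qed
    then show "b \<in> middle_nucleus A" unfolding middle_nucleus_iff by (simp add: \<beta>(1))
  qed
qed

text \<open>On monomials of degree 1 the product multiplies coefficients. The map
  \<open>\<theta>\<close> is the identity for the left nucleus and the center, and
  \<open>\<sigma>\<close> for the middle nucleus.\<close>

lemma monomials_isomorphic:
  assumes "skew_poly \<theta>" "\<And>k. k \<in> K' \<Longrightarrow> \<theta> k = k"
  shows "algebra_isomorphic K' (restrict_to A ((\<lambda>\<alpha>. monom (\<theta> \<alpha>) 1) ` W)) (subfield_algebra W)"
proof -
  interpret \<theta>: skew_poly \<theta> by (rule assms(1))
  define h where "h a = inv_into UNIV \<theta> (coeff a 1)" for a
  have h: "h (monom (\<theta> \<alpha>) 1) = \<alpha>" for \<alpha>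
    using \<theta>.sigma_bij by (simp add: h_def bij_is_inj)
  have h_add: "h (monom (\<theta> \<alpha>) 1 + monom (\<theta> \<beta>) 1) = \<alpha> + \<beta>" for \<alpha> \<beta>
    using h[of "\<alpha> + \<beta>"] by (simp add: add_monom)
  have h_star: "h (monom (\<theta> \<alpha>) 1 \<star> monom (\<theta> \<beta>) 1) = \<alpha> * \<beta>" for \<alpha> \<beta>
    using h[of "\<alpha> * \<beta>"] monom_1_star[of "monom (\<theta> \<beta>) 1" "\<theta> \<alpha>"] by (simp add: smult_monom)
  have h_smult: "h (smult k (monom (\<theta> \<alpha>) 1)) = k * \<alpha>" if "k \<in> K'" for k \<alpha>
    using h[of "k * \<alpha>"] assms(2)[OF that] by (simp add: smult_monom)
  have h_one: "h \<xi> = 1" using h[of 1] by simp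
  have "h \<in> ring_iso (restrict_to A ((\<lambda>\<alpha>. monom (\<theta> \<alpha>) 1) ` W)) (subfield_algebra W)"
    unfolding ring_iso_def
  proof (intro CollectI conjI)
    show "h \<in> Ring.ring_hom (restrict_to A ((\<lambda>\<alpha>. monom (\<theta> \<alpha>) 1) ` W)) (subfield_algebra W)"
      by (rule ring_hom_memI)
        (auto simp: subfield_algebra_def h h_add h_star h_one simp del: One_nat_def)
    show "bij_betw h (carrier (restrict_to A ((\<lambda>\<alpha>. monom (\<theta> \<alpha>) 1) ` W))) (carrier (subfield_algebra W))"
      by (rule bij_betwI[where g = "\<lambda>\<alpha>. monom (\<theta> \<alpha>) 1"])
        (auto simp: subfield_algebra_def h simp del: One_nat_def)
  qed
  then show ?thesis
    unfolding algebra_isomorphic_def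
    by (rule bexI[rotated]) (auto simp: subfield_algebra_def h h_smult simp del: One_nat_def)
qed

section \<open>The right nucleus and the eigenring\<close>

definition E :: "'a poly set" where "E = {e. degree e < d \<and> f \<diamondop> e \<in> Rf}"

lemma zero_star: "0 \<star> w = 0"
  by (simp add: star_eq lift_eq_self)

text \<open>Membership of \<open>f \<diamondop> e\<close> in \<open>Rf\<close> extends to all left
  multiples of \<open>f\<close>, so right multiplication by \<open>e\<close> is well defined on
  \<open>R/Rf\<close>.\<close>

lemma E_mult_Rf:
  assumes "e \<in> E" "p \<in> Rf"
  shows "p \<diamondop> e \<in> Rf"
proof -
  obtain q where "p = q \<diamondop> f" using assms(2) by (auto simp: mem_Rf_iff)
  then show ?thesis using assms(1) by (simp add: E_def skew_mult_assoc mult_Rf)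
qed

lemma E_cong: "e \<in> E \<Longrightarrow> p - q \<in> Rf \<Longrightarrow> md (p \<diamondop> e) = md (q \<diamondop> e)"
  using E_mult_Rf[of e "p - q"] by (simp add: md_eq_iff skew_distrib)

lemma star_E:
  assumes "e \<in> E" "degree b < d"
  shows "b \<star> md (\<xi> \<diamondop> e) = md (b \<diamondop> e)"
proof -
  have "b \<star> md (\<xi> \<diamondop> e) = md (lift b \<diamondop> (u \<diamondop> (\<xi> \<diamondop> e)))"
    using md_mult[of "lift b \<diamondop> u" "\<xi> \<diamondop> e"] by (simp add: star_eq skew_mult_assoc)
  also have "\<dots> = md (lift b \<diamondop> e)" by (rule md_cong_Ann[OF cancel_u_X])
  also have "\<dots> = md (b \<diamondop> e)" by (rule E_cong[OF assms(1) lift_diff_Rf])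
  finally show ?thesis .
qed

text \<open>By \<open>star_E\<close>, multiplying by this element on the right is the module
  endomorphism given by \<open>e\<close>, which commutes with the left action of
  \<open>lift a \<diamondop> u\<close>.\<close>

lemma E_right_nucleus:
  assumes "e \<in> E"
  shows "md (\<xi> \<diamondop> e) \<in> right_nucleus A"
proof -
  have "a \<star> (b \<star> md (\<xi> \<diamondop> e)) = (a \<star> b) \<star> md (\<xi> \<diamondop> e)" if "degree a < d" "degree b < d" for a b
  proof -
    have "(a \<star> b) \<star> md (\<xi> \<diamondop> e) = md (md (lift a \<diamondop> (u \<diamondop> b)) \<diamondop> e)"
      by (subst star_E[OF assms]) (simp_all add: star_eq)
    also have "\<dots> = md ((lift a \<diamondop> (u \<diamondop> b)) \<diamondop> e)"
      by (rule E_cong[OF assms Rf_sym[OF diff_md_Rf]])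
    also have "\<dots> = a \<star> md (b \<diamondop> e)"
      using md_mult[of "lift a \<diamondop> u" "b \<diamondop> e"] by (simp add: star_eq skew_mult_assoc)
    finally show ?thesis by (simp only: star_E[OF assms that(2)])
  qed
  then show ?thesis by (simp add: right_nucleus_def)
qed

text \<open>For \<open>w\<close> in the right nucleus, \<open>b \<mapsto> b \<star> w\<close> commutes with left multiplication by \<open>\<alpha> x\<close> and \<open>x\<^sup>2\<close> in \<open>A\<close>,
  which are left multiplication by \<open>\<alpha>\<close> and \<open>x\<close> on \<open>R/Rf\<close>; hence it is an endomorphism of the left
  module \<open>R/Rf\<close>.\<close>
lemma right_nucleus_E:
  assumes "w \<in> right_nucleus A"
  obtains e where "e \<in> E" "w = md (\<xi> \<diamondop> e)"
proof -
  have w: "degree w < d" "\<And>a b. degree a < d \<Longrightarrow> degree b < d \<Longrightarrow> a \<star> (b \<star> w) = (a \<star> b) \<star> w"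
    using assms by (auto simp: right_nucleus_def)
  \<comment> \<open>This is the value of the map at the coset of 1, which generates
    \<open>R/Rf\<close> and so determines an endomorphism.\<close>
  define e where "e = 1 \<star> w"
  have step: "md (\<xi> \<diamondop> b) \<star> w = md (\<xi> \<diamondop> (b \<star> w))" if "degree b < d" for b
  proof -
    have "monom 1 2 \<star> (b \<star> w) = (monom 1 2 \<star> b) \<star> w"
      using that degree_f_gt_2 by (intro w) (simp_all add: degree_monom_eq)
    then show ?thesis
      using monom_star[of b 1 1] monom_star[of "b \<star> w" 1 1] that by (simp add: numeral_2_eq_2)
  qed
  have power: "md (monom 1 i) \<star> w = md (monom 1 i \<diamondop> e)" for i
  proof (induction i)
    case 0
    then show ?case by (simp add: e_def)
  next
    case (Suc i)
    have x: "monom 1 (Suc i) = \<xi> \<diamondop> monom 1 i" by (simp add: monom_mult_monom)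
    have "md (monom 1 (Suc i)) \<star> w = md (\<xi> \<diamondop> md (monom 1 i)) \<star> w"
      unfolding x md_mult ..
    also have "\<dots> = md (\<xi> \<diamondop> (md (monom 1 i) \<star> w))" by (rule step) simp
    also have "\<dots> = md (monom 1 (Suc i) \<diamondop> e)" unfolding Suc x by (simp add: md_mult skew_mult_assoc)
    finally show ?case .
  qed
  have scalar: "smult \<alpha> b \<star> w = smult \<alpha> (b \<star> w)" if "degree b < d" for \<alpha> b
    using w(2)[of "monom \<alpha> 1" b] that by (simp add: monom_1_star[simplified])
  have sum: "sum g I \<star> w = (\<Sum>i\<in>I. g i \<star> w)" for g and I :: "nat set"
    by (induction I rule: infinite_finite_induct)
      (auto simp: star_add_left zero_star)
  have mult: "md p \<star> w = md (p \<diamondop> e)" for p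
  proof -
    have p: "p = (\<Sum>i\<le>degree p. smult (coeff p i) (monom 1 i))"
      by (simp add: smult_monom poly_as_sum_of_monoms)
    have "md p \<star> w = (\<Sum>i\<le>degree p. smult (coeff p i) (md (monom 1 i))) \<star> w"
      by (subst p) (simp add: md_sum md_smult del: md_small)
    also have "\<dots> = (\<Sum>i\<le>degree p. smult (coeff p i) (md (monom 1 i \<diamondop> e)))"
      by (simp add: sum scalar power)
    also have "\<dots> = md ((\<Sum>i\<le>degree p. smult (coeff p i) (monom 1 i)) \<diamondop> e)"
      by (simp add: skew_mult_sum_left md_sum md_smult skew_mult_smult_left del: md_small)
    finally show ?thesis using p by simp
  qed
  \<comment> \<open>The coset of \<open>f\<close> is zero, hence so is its image
    \<open>f \<diamondop> e\<close>; this is the eigenring condition.\<close>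
  have "md (f \<diamondop> e) = 0" using mult[of f] md_eq_0_iff[of f] by (simp add: zero_star)
  then have "e \<in> E" by (simp add: E_def e_def md_eq_0_iff)
  moreover have "w = md (\<xi> \<diamondop> e)" using mult[of \<xi>] X_star[OF w(1)] by simp
  ultimately show thesis using that by blast
qed

lemma right_nucleus_eq: "right_nucleus A = (\<lambda>e. md (\<xi> \<diamondop> e)) ` E"
  using E_right_nucleus right_nucleus_E by blast

text \<open>Left multiplication by \<open>u\<close> inverts
  \<open>e \<mapsto> md (\<xi> \<diamondop> e)\<close>. Scalars from \<open>K'\<close> pass through
  \<open>u\<close> because \<open>\<sigma>\<close> fixes them.\<close>

lemma right_nucleus_isomorphic:
  "algebra_isomorphic K' (restrict_to A (right_nucleus A)) (eigenring \<sigma> f)"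
proof -
  define h where "h w = md (u \<diamondop> w)" for w
  have h_E: "h (md (\<xi> \<diamondop> e)) = e" if "e \<in> E" for e
    using md_mult[of u "\<xi> \<diamondop> e"] md_cong_Ann[OF cancel_u_X[of 1 e]] that
    by (simp add: h_def E_def)
  have h_add: "h (v + w) = h v + h w" for v w by (simp add: h_def skew_distrib md_add)
  have h_smult: "h (smult k w) = smult k (h w)" if "k \<in> K'" for k w
    using K'_fixed(2)[OF that] by (simp add: h_def skew_mult_smult_right md_smult)
  have h_star: "h (md (\<xi> \<diamondop> e) \<star> md (\<xi> \<diamondop> e')) = md (e \<diamondop> e')" if "e \<in> E" "e' \<in> E" for e e'
  proof -
    have "md (\<xi> \<diamondop> e) \<star> md (\<xi> \<diamondop> e') = md (md (\<xi> \<diamondop> e) \<diamondop> e')"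
      by (rule star_E[OF that(2)]) simp
    also have "\<dots> = md ((\<xi> \<diamondop> e) \<diamondop> e')"
      by (rule E_cong[OF that(2) Rf_sym[OF diff_md_Rf]])
    finally have "h (md (\<xi> \<diamondop> e) \<star> md (\<xi> \<diamondop> e')) = md (u \<diamondop> ((\<xi> \<diamondop> e) \<diamondop> e'))"
      by (simp add: h_def md_mult)
    also have "\<dots> = md (e \<diamondop> e')"
      using md_cong_Ann[OF cancel_u_X[of 1 "e \<diamondop> e'"]] by (simp add: skew_mult_assoc)
    finally show ?thesis .
  qed
  have one: "1 \<in> E" "md (\<xi> \<diamondop> 1) = \<xi>" by (simp_all add: E_def)
  have eigenring_simps: "carrier (eigenring \<sigma> f) = E" "\<one>\<^bsub>eigenring \<sigma> f\<^esub> = 1"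
    "a \<otimes>\<^bsub>eigenring \<sigma> f\<^esub> b = md (a \<diamondop> b)" "a \<oplus>\<^bsub>eigenring \<sigma> f\<^esub> b = a + b"
    "k \<odot>\<^bsub>eigenring \<sigma> f\<^esub> a = smult k a" for a b k
    by (simp_all add: eigenring_def E_def Rf_def)
  have "h \<in> ring_iso (restrict_to A (right_nucleus A)) (eigenring \<sigma> f)"
    unfolding ring_iso_def
  proof (intro CollectI conjI)
    show "h \<in> Ring.ring_hom (restrict_to A (right_nucleus A)) (eigenring \<sigma> f)"
    proof (rule ring_hom_memI)
      show "h \<one>\<^bsub>restrict_to A (right_nucleus A)\<^esub> = \<one>\<^bsub>eigenring \<sigma> f\<^esub>"
        using h_E[OF one(1)] one(2) by (simp add: eigenring_simps)
    qed (auto simp: right_nucleus_eq eigenring_simps h_E h_add h_star simp del: One_nat_def)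
    show "bij_betw h (carrier (restrict_to A (right_nucleus A))) (carrier (eigenring \<sigma> f))"
      by (rule bij_betwI[where g = "\<lambda>e. md (\<xi> \<diamondop> e)"])
        (auto simp: right_nucleus_eq eigenring_simps h_E simp del: One_nat_def)
  qed
  then show ?thesis
    unfolding algebra_isomorphic_def
    by (rule bexI[rotated]) (auto simp: eigenring_simps h_smult)
qed

text \<open>The left nucleus already gives \<open>monom \<alpha> 1\<close> with
  \<open>\<alpha>\<close> fixed by \<open>\<rho>\<close>. Commuting with \<open>monom 1 2\<close>,
  which acts as \<open>x\<close> on \<open>R/Rf\<close>, forces
  \<open>\<sigma> \<alpha> = \<alpha>\<close>.\<close>

lemma algebra_center_eq: "algebra_center A = (\<lambda>\<alpha>. monom \<alpha> 1) ` K'"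
proof (intro equalityI subsetI)
  fix a assume a: "a \<in> algebra_center A"
  then obtain \<alpha> where \<alpha>: "a = monom \<alpha> 1" "\<rho> \<alpha> = \<alpha>"
    by (auto simp: algebra_center_def left_nucleus_eq fixed_by_def)
  have deg: "degree (monom (1::'a) 2) < d" using degree_f_gt_2 by (simp add: degree_monom_eq)
  then have "a \<star> monom 1 2 = monom 1 2 \<star> a"
    using a by (auto simp: algebra_center_def commutative_center_def)
  moreover have "a \<star> monom 1 2 = monom \<alpha> 2"
    using monom_1_star[OF deg, of \<alpha>] by (simp add: \<alpha>(1) smult_monom)
  moreover have "monom 1 2 \<star> a = monom (\<sigma> \<alpha>) 2"
    using monom_star[of a 1 1] degree_f_gt_2 by (simp add: \<alpha>(1) monom_mult_monom numeral_2_eq_2)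
  ultimately have "\<sigma> \<alpha> = \<alpha>" by (simp add: monom_eq_iff)
  then show "a \<in> (\<lambda>\<alpha>. monom \<alpha> 1) ` K'" using \<alpha> by (auto simp: K'_eq fixed_by_def)
next
  fix a assume "a \<in> (\<lambda>\<alpha>. monom \<alpha> 1) ` K'"
  then obtain \<alpha> where \<alpha>: "a = monom \<alpha> 1" "\<rho> \<alpha> = \<alpha>" "\<sigma> \<alpha> = \<alpha>"
    using K'_fixed by auto
  have pow: "(\<sigma> ^^ i) \<alpha> = \<alpha>" for i using \<alpha>(3) by (induction i) auto
  have "\<alpha> \<in> fixed_by (inv_into UNIV \<rho> \<circ> \<sigma> ^^ d)"
    using skew_poly.sigma_bij[OF rho] \<alpha>(2) by (simp add: fixed_by_def pow bij_is_inj inv_f_eq)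
  then have middle: "a \<in> middle_nucleus A"
    unfolding middle_nucleus_eq using \<alpha>(1,3) by (metis (mono_tags, lifting) image_eqI)
  have "monom \<alpha> 0 \<in> E"
    using smult_Rf[OF f_Rf] by (simp add: E_def mult_monom_0_fixed[OF \<alpha>(3)])
  moreover have "md (\<xi> \<diamondop> monom \<alpha> 0) = a"
    by (simp add: \<alpha> monom_mult_monom)
  ultimately have right: "a \<in> right_nucleus A"
    using E_right_nucleus[of "monom \<alpha> 0"] by simp
  have "a \<star> b = b \<star> a" if "degree b < d" for b
    using monom_1_star[OF that, of \<alpha>] star_X[OF that] star_smult_right[OF \<alpha>(3), of b \<xi>]
    by (simp add: \<alpha>(1) smult_monom)
  then have "a \<in> commutative_center A"
    by (simp add: commutative_center_def \<alpha>(1))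
  moreover have "a \<in> left_nucleus A"
    using \<alpha> by (auto simp: left_nucleus_eq fixed_by_def)
  ultimately show "a \<in> algebra_center A"
    using middle right by (simp add: algebra_center_def)
qed

lemma id_skew_poly: "skew_poly (\<lambda>a::'a. a)"
  by unfold_locales (auto intro: bij_id[unfolded id_def])

lemma star_algebra_nuclei:
  "algebra_isomorphic K' (restrict_to A (left_nucleus A)) (subfield_algebra (fixed_by \<rho>))"
  "algebra_isomorphic K' (restrict_to A (middle_nucleus A))
    (subfield_algebra (fixed_by (inv_into UNIV \<rho> \<circ> \<sigma> ^^ d)))"
  "algebra_isomorphic K' (restrict_to A (algebra_center A)) (subfield_algebra K')"
  unfolding left_nucleus_eq middle_nucleus_eq algebra_center_eq
  using monomials_isomorphic[OF id_skew_poly] monomials_isomorphic[OF skew_poly_axioms K'_fixed(2)]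
  by blast+

end

section \<open>Bounds and norms\<close>

lemma ring_iso_fld_skew_poly:
  assumes "\<tau> \<in> ring_iso fld (fld :: 'a::field ring)"
  shows "skew_poly \<tau>"
  using assms by unfold_locales (auto simp: ring_iso_def ring_hom_add ring_hom_mult
      dest: ring_hom_add ring_hom_mult)

text \<open>An element fixed by the generator is fixed by all its powers, hence by the whole Galois
  group.\<close>

lemma cyclic_galois_fixed_field:
  assumes "cyclic_galois K n \<sigma>"
  shows "fixed_by \<sigma> = K"
proof
  show "K \<subseteq> fixed_by \<sigma>" using assms by (auto simp: cyclic_galois_def galois_group_def)
  show "fixed_by \<sigma> \<subseteq> K"
  proof
    fix a assume "a \<in> fixed_by \<sigma>"
    then have "(\<sigma> ^^ i) a = a" for i by (induction i) (auto simp: fixed_by_def)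
    then have "a \<in> (\<Inter>\<tau>\<in>galois_group K. fixed_by \<tau>)"
      using assms by (auto simp: cyclic_galois_def fixed_by_def)
    moreover have "(\<Inter>\<tau>\<in>galois_group K. fixed_by \<tau>) = K"
      using assms unfolding cyclic_galois_def by blast
    ultimately show "a \<in> K" by (simp only:)
  qed
qed

lemma subfield_fixed_by_inter:
  assumes "skew_poly \<rho>" "subfield K fld"
  shows "subfield (fixed_by \<rho> \<inter> K) fld"
proof -
  interpret skew_poly \<rho> by (rule assms(1))
  have "\<rho> (inverse a) = inverse (\<rho> a)" for a
    using sigma_divide[of 1 a] by (simp add: divide_inverse)
  then show ?thesis
    using subfield_closed[OF assms(2)] inverse_mem_subfield[OF assms(2)]
    by (intro subfield_fldI) (auto simp: fixed_by_def)
qed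

text \<open>The determinant in any basis is multiplicative and invariant under automorphisms fixing
  \<open>F\<close>, so the nonzero norms of \<open>a\<close> and \<open>t\<close> cancel from the
  equation.\<close>

lemma field_norm_eq_1:
  assumes "subfield F fld" "ring.finite_dimension fld F UNIV"
    and \<rho>: "skew_poly \<rho>" "F \<subseteq> fixed_by \<rho>" and \<sigma>: "skew_poly \<sigma>" "F \<subseteq> fixed_by \<sigma>"
    and "a \<noteq> 0" "t \<noteq> 0" "a * t = e * \<rho> a * \<sigma> t"
  shows "field_norm F e = 1"
proof (rule field_norm_eqI[OF assms(1,2)])
  fix bs assume "subfield_basis F bs"
  then interpret subfield_basis F bs .
  interpret \<rho>: skew_poly \<rho> by (rule \<rho>(1))
  interpret \<sigma>: skew_poly \<sigma> by (rule \<sigma>(1))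
  have "bnorm (\<rho> a) = bnorm a"
    by (rule bnorm_automorphism) (use \<rho>(2) in \<open>auto simp: \<rho>.sigma_bij fixed_by_def\<close>)
  moreover have "bnorm (\<sigma> t) = bnorm t"
    by (rule bnorm_automorphism) (use \<sigma>(2) in \<open>auto simp: \<sigma>.sigma_bij fixed_by_def\<close>)
  moreover have "bnorm (a * t) = bnorm (e * \<rho> a * \<sigma> t)" using assms(9) by simp
  ultimately show "bnorm e = 1"
    using bnorm_nonzero[OF assms(7)] bnorm_nonzero[OF assms(8)] by (simp add: bnorm_mult)
qed

context skew_quotient
begin

lemma ideal_annihilator: "ideal {p. \<forall>r. p \<diamondop> r \<in> Rf} (skew_ring \<sigma>)"
proof (rule idealI[OF ring_skew_ring])
  interpret ring "skew_ring \<sigma>" by (rule ring_skew_ring)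
  have inv: "\<ominus>\<^bsub>skew_ring \<sigma>\<^esub> p = - p" for p
    by (rule minus_equality) auto
  show "subgroup {p. \<forall>r. p \<diamondop> r \<in> Rf} (add_monoid (skew_ring \<sigma>))"
    by (rule add.subgroupI)
      (auto simp: skew_distrib add_Rf a_inv_def[symmetric] inv skew_mult_minus_left
        intro!: exI[of _ 0])
qed (auto simp: skew_mult_assoc mult_Rf)

text \<open>The annihilator is a two-sided ideal inside \<open>Rf\<close>, so it lies in the largest
  one, which the bound generates.\<close>

lemma bound_contains_annihilator:
  assumes "is_bound \<sigma> f c" "\<And>r. p \<diamondop> r \<in> Rf"
  shows "\<exists>q. p = q \<diamondop> c"
proof -
  have "{p. \<forall>r. p \<diamondop> r \<in> Rf} \<subseteq> cgenideal (skew_ring \<sigma>) f"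
    using skew_mult_1_right unfolding Rf_def[symmetric] by (metis (mono_tags) mem_Collect_eq subsetI)
  then have "{p. \<forall>r. p \<diamondop> r \<in> Rf} \<subseteq> cgenideal (skew_ring \<sigma>) c"
    using assms(1) ideal_annihilator by (simp add: is_bound_def Let_def)
  then show ?thesis using assms(2) mem_cgenideal_iff by blast
qed

text \<open>The bound is a left multiple of \<open>f\<close>; comparing degrees and leading
  coefficients makes the quotient 1. This rules out a bound with a single irreducible
  factor.\<close>

lemma bound_eq_self:
  assumes "is_bound \<sigma> f c" "degree c = d"
  shows "c = f"
proof -
  have lead: "lead_coeff c = 1" using assms(1) by (simp add: is_bound_def Let_def)
  have "c \<in> cgenideal (skew_ring \<sigma>) c"
    unfolding mem_cgenideal_iff by (rule exI[of _ 1]) simp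
  then have "c \<in> cgenideal (skew_ring \<sigma>) f"
    using assms(1) unfolding is_bound_def Let_def by blast
  then obtain q where q: "c = q \<diamondop> f"
    unfolding mem_cgenideal_iff by blast
  then have "q \<noteq> 0" using lead by auto
  then have "degree q = 0" using q assms(2) degree_skew_mult[of q f] by simp
  moreover have "lead_coeff q = 1" using q lead lead_coeff_skew_mult[of q f] monic_f by simp
  ultimately have "q = 1" by (metis degree_eq_zeroE lead_coeff_pCons(2) one_pCons pCons_0_0)
  then show ?thesis using q by simp
qed

end

lemma (in skew_poly) monom_1_central:
  assumes "\<sigma> ^^ k = id"
  shows "monom 1 k \<diamondop> r = r \<diamondop> monom 1 k"
  by (rule poly_eqI) (simp add: coeff_monom_mult coeff_mult_monom assms)

text \<open>Commuting a constant past \<open>c\<close> and comparing leading coefficients gives the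
  claim.\<close>

lemma (in skew_poly) central_imp_sigma_power_eq_id:
  assumes "lead_coeff c = 1" "c \<in> commutative_center (skew_ring \<sigma>)"
  shows "\<sigma> ^^ degree c = id"
proof
  fix a
  have "c \<diamondop> monom a 0 = monom a 0 \<diamondop> c" using assms(2) by (auto simp: commutative_center_def)
  then have "coeff (c \<diamondop> monom a 0) (degree c) = coeff (monom a 0 \<diamondop> c) (degree c)" by simp
  then show "(\<sigma> ^^ degree c) a = id a"
    using assms(1) by (simp add: coeff_monom_mult coeff_mult_monom)
qed

lemma degree_at_power: "degree (at_power F n) = degree F * n"
  by (simp add: at_power_def degree_pcompose degree_monom_eq)

theorem mainTheorem14:
  fixes K K' :: "'a::field set"
    and \<sigma> \<rho> :: "'a \<Rightarrow> 'a"
    and \<eta> :: 'a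
    and f F z u :: "'a poly"
    and A :: "('a, 'a poly) module"
    and n s l :: nat
    and ps :: "'a poly list"
  assumes "n \<ge> 2"
    and "cyclic_galois K n \<sigma>"
    and "lead_coeff f = 1"
    and "irreducible_elt (skew_ring \<sigma>) f"
    and "f \<notin> commutative_center (skew_ring \<sigma>)"
    and "lead_coeff F = 1"
    and "irreducible_elt (poly_over K) F"
    and "degree F = s"
    and "F \<noteq> monom 1 1"
    and "is_bound \<sigma> f (at_power F n)"
    and "irreducible_factorization (skew_ring \<sigma>) (at_power F n) ps"
    and "l * length ps = n"
    and "degree f = s * l"
    and "\<rho> \<in> ring_iso fld fld"
    and "K' = fixed_by \<rho> \<inter> K"
    and "ring.finite_dimension fld K' K"
    and "\<eta> \<noteq> 0"
    and "field_norm K' (\<eta> * coeff f 0) \<noteq> 1"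
    and "s * l > 2"
    and "at_power z n \<in> commutative_center (skew_ring \<sigma>)"
    and "skew_mult \<sigma> (at_power z n) (monom 1 (s * n)) - 1 \<in> cgenideal (skew_ring \<sigma>) f"
    and "u = skew_mult \<sigma> (at_power z n) (monom 1 (s * n - 1))"
    and "A = star_algebra \<sigma> \<rho> \<eta> f u"
  shows "unital_division_algebra (fld\<lparr>carrier := K'\<rparr>) A \<and>
    algebra_isomorphic K' (restrict_to A (left_nucleus A)) (subfield_algebra (fixed_by \<rho>)) \<and>
    algebra_isomorphic K' (restrict_to A (middle_nucleus A))
      (subfield_algebra (fixed_by (inv_into UNIV \<rho> \<circ> (\<sigma> ^^ (s * l))))) \<and>
    algebra_isomorphic K' (restrict_to A (right_nucleus A)) (eigenring \<sigma> f) \<and>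
    algebra_isomorphic K' (restrict_to A (algebra_center A)) (subfield_algebra K')"
proof -
  interpret fld: field "fld :: 'a ring" by (rule field_from_type_algebra)
  note [simp] = assms(23)
  let ?c = "at_power F n"
  have gal: "subfield K fld" "ring.dimension fld n K UNIV" "\<sigma> \<in> ring_iso fld fld"
    using assms(2) by (auto simp: cyclic_galois_def galois_group_def)
  interpret skew_poly \<sigma> by (rule ring_iso_fld_skew_poly[OF gal(3)])
  have \<rho>: "skew_poly \<rho>" by (rule ring_iso_fld_skew_poly[OF assms(14)])
  have "degree f > 0" using assms(13,19) by linarith
  then interpret skew_quotient \<sigma> f
    using assms(3) by unfold_locales
  have K'_eq: "K' = fixed_by \<rho> \<inter> fixed_by \<sigma>"
    using assms(15) cyclic_galois_fixed_field[OF assms(2)] by simp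
  have subfield_K': "subfield K' fld"
    using subfield_fixed_by_inter[OF \<rho> gal(1)] assms(15) by simp
  have finite_K': "ring.finite_dimension fld K' UNIV"
    using fld.telescopic_base_dim(1)[OF subfield_K' gal(1) assms(16)] gal(2)
    by (auto simp: fld.finite_dimension_def)
  have c: "lead_coeff ?c = 1" "?c \<in> commutative_center (skew_ring \<sigma>)"
    using assms(10) by (auto simp: is_bound_def Let_def)
  have degree_c: "degree ?c = s * n"
    using assms(8) by (simp add: degree_at_power)
  \<comment> \<open>No factors would contradict \<open>n \<ge> 2\<close>, and one factor would make
    \<open>f\<close> equal to its central bound. Hence the bound has degree at least
    \<open>2 * d\<close>, which exceeds \<open>d + 1\<close>.\<close>
  have "length ps \<noteq> 0" using assms(1,12) by auto
  moreover have "length ps \<noteq> 1"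
  proof
    assume "length ps = 1"
    then have "?c = f" using bound_eq_self[OF assms(10)] degree_c assms(12,13) by simp
    then show False using c(2) assms(5) by simp
  qed
  ultimately have "length ps \<ge> 2" by linarith
  then have "d * 2 \<le> d * length ps" by (rule mult_le_mono2)
  moreover have "d * length ps = s * n" using assms(12,13) by (metis mult.assoc)
  ultimately have degree_c_gt: "degree ?c > d + 1" using degree_c assms(13,19) by linarith
  have sn: "s * n > 0" using degree_c_gt degree_c by linarith
  let ?z = "at_power z n"
  have z: "?z \<diamondop> r = r \<diamondop> ?z" for r
    using assms(20) by (auto simp: commutative_center_def)
  have Suc_sn: "Suc (s * n - 1) = s * n" using sn by simp
  have u_X: "u \<diamondop> monom 1 1 = ?z \<diamondop> monom 1 (s * n)"
    unfolding assms(22) skew_mult_assoc using Suc_sn by (simp add: monom_mult_monom)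
  have X_u: "monom 1 1 \<diamondop> u = ?z \<diamondop> monom 1 (s * n)"
  proof -
    have "monom 1 1 \<diamondop> u = ?z \<diamondop> (monom 1 1 \<diamondop> monom 1 (s * n - 1))"
      unfolding assms(22) by (simp only: skew_mult_assoc[symmetric] z[of "monom 1 1"])
    then show ?thesis using Suc_sn by (simp add: monom_mult_monom)
  qed
  have "\<sigma> ^^ (s * n) = id"
    using central_imp_sigma_power_eq_id[OF c] degree_c by simp
  \<comment> \<open>Both \<open>?z\<close> and the power of \<open>x\<close> are central, so their
    product may be moved past any \<open>r\<close>.\<close>
  then have w: "(?z \<diamondop> monom 1 (s * n)) \<diamondop> r = r \<diamondop> (?z \<diamondop> monom 1 (s * n))" for r
    by (metis monom_1_central skew_mult_assoc z)
  interpret star_setting \<sigma> f \<rho> \<eta> ?c u K'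
  proof (rule star_setting.intro[OF skew_quotient_axioms], rule star_setting_axioms.intro)
    show "irreducible_elt (skew_ring \<sigma>) f" "2 < d" "skew_poly \<rho>" "\<eta> \<noteq> 0"
      using assms(4,13,17,19) \<rho> by simp_all
    show "a * t \<noteq> \<eta> * \<rho> a * coeff f 0 * \<sigma> t" if "a \<noteq> 0" "t \<noteq> 0" for a t
    proof
      assume "a * t = \<eta> * \<rho> a * coeff f 0 * \<sigma> t"
      then have "field_norm K' (\<eta> * coeff f 0) = 1"
        using K'_eq that
        by (intro field_norm_eq_1[OF subfield_K' finite_K' \<rho> _ skew_poly_axioms]) (auto simp: mult_ac)
      then show False using assms(18) by simp
    qed
    show "(monom 1 1 \<diamondop> u - 1) \<diamondop> r \<in> Rf" for r
    proof -
      \<comment> \<open>Centrality turns the left factor into a right factor, giving a left multiple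
        of an element of \<open>Rf\<close>.\<close>
      have "(monom 1 1 \<diamondop> u - 1) \<diamondop> r = r \<diamondop> (?z \<diamondop> monom 1 (s * n) - 1)"
        unfolding X_u by (simp add: skew_distrib w)
      then show ?thesis using assms(21) by (simp add: mult_Rf Rf_def[symmetric])
    qed
    show "u \<diamondop> monom 1 1 = monom 1 1 \<diamondop> u" unfolding u_X X_u ..
    show "\<exists>q. p = q \<diamondop> ?c" if "\<And>r. p \<diamondop> r \<in> Rf" for p
      using bound_contains_annihilator[OF assms(10)] that by blast
  qed (use K'_eq subfield_K' finite_K' degree_c_gt in auto)
  show ?thesis
    using star_algebra_division star_algebra_nuclei right_nucleus_isomorphic
    by (simp add: assms(13))
qed

end
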